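(* Let $s_0=\lceil\log_2\log_2 4n\rceil$ and $c=\frac32$, and run the algorithm AdaVRAE (described in the context) with the parameters $$a^{(s)}=\begin{cases}(4n)^{-0.5^{s}} & 1\le s\le s_0\\ \frac{s-s_0-1+c}{2c} & s>s_0\end{cases},\qquad T_s=n,\qquad A_{T_0}^{(0)}=\frac54,$$ where $(4n)^{-0.5^s}$ means $(4n)^{-(0.5^s)}$, with arbitrary $\gamma>0$ and $\eta>0$. Assume $\mathcal X$ is a compact convex set with diameter $D$. Set $$V=\frac52\left(F(u^{(0)})-F(x^* )\right)+\gamma\left\|u^{(0)}-x^*\right\|^2+\frac{16\beta\left(D^4+2\eta^4\right)}{\eta^2}.$$ Then for every $\epsilon>0$ there is a number of epochs $S\ge1$ such that the output satisfies $\mathbb E\left[F(u^{(S)})-F(x^* )\right]\le\epsilon$ and the number of individual gradient evaluations used is $$\#grads=\begin{cases}\mathcal O\left(n\log\log\frac V\epsilon\right)&\text{if }\epsilon\ge\frac Vn\\[2pt] \mathcal O\left(n\log\log n+\sqrt{\frac{Vn}{\epsilon}}\right)&\text{if }\epsilon<\frac Vn\end{cases}.$$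
   Context: Problem. $n,d\ge1$ are integers, $\mathcal X\subseteq\mathbb R^d$ is a nonempty closed convex set, $f_1,\dots,f_n:\mathbb R^d\to\mathbb R$ are convex, differentiable and $\beta$-smooth with $\beta>0$, i.e. $\|\nabla f_i(x)-\nabla f_i(y)\|\le\beta\|x-y\|$ for all $x,y\in\mathbb R^d$; $f=\frac1n\sum_{i=1}^n f_i$; $h:\mathcal X\to\mathbb R$ is convex, possibly nonsmooth, and such that $\arg\min_{x\in\mathcal X}(\lambda h(x)+\frac12\|x-v\|^2)$ exists for all $\lambda\ge0$, $v\in\mathbb R^d$. $F=f+h$ and $x^*\in\arg\min_{x\in\mathcal X}F(x)$ (assumed to exist). $\|\cdot\|$ is the Euclidean norm. "Diameter $D$" means $\sup_{x,y\in\mathcal X}\|x-y\|\le D$, $D>0$. Algorithm AdaVRAE. Input $u^{(0)}\in\mathcal X$. Parameters: $a^{(s)}>0$, positive integers $T_s$ ($s\ge1$), $A_{T_0}^{(0)}>0$, $\eta>0$, $\gamma>0$. Initialize $\overline x_0^{(1)}=z_0^{(1)}=u^{(0)}$, $g_0^{(1)}=\nabla f(u^{(0)})$, $\gamma_0^{(1)}=\gamma$. For $s=1,\dots,S$: set $A_0^{(s)}=A_{T_{s-1}}^{(s-1)}-T_s(a^{(s)})^2$; for $t=1,\dots,T_s$: - $x_t^{(s)}=\arg\min_{x\in\mathcal X}\{a^{(s)}\langle g_{t-1}^{(s)},x\rangle+a^{(s)}h(x)+\frac{\gamma_{t-1}^{(s)}}2\|x-z_{t-1}^{(s)}\|^2\}$;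 - $A_t^{(s)}=A_{t-1}^{(s)}+a^{(s)}+(a^{(s)})^2$ and $\overline x_t^{(s)}=\frac1{A_t^{(s)}}\left(A_{t-1}^{(s)}\overline x_{t-1}^{(s)}+a^{(s)}x_t^{(s)}+(a^{(s)})^2u^{(s-1)}\right)$; - if $t\ne T_s$: draw $i_t^{(s)}$ uniformly from $\{1,\dots,n\}$, independently of everything before, and set $g_t^{(s)}=\nabla f_{i_t^{(s)}}(\overline x_t^{(s)})-\nabla f_{i_t^{(s)}}(u^{(s-1)})+\nabla f(u^{(s-1)})$; if $t=T_s$: $g_t^{(s)}=\nabla f(\overline x_t^{(s)})$; - $\gamma_t^{(s)}=\frac1\eta\sqrt{\eta^2(\gamma_{t-1}^{(s)})^2+(a^{(s)})^2\|g_t^{(s)}-g_{t-1}^{(s)}\|^2}$; - $z_t^{(s)}=\arg\min_{z\in\mathcal X}\{a^{(s)}\langle g_t^{(s)},z\rangle+a^{(s)}h(z)+\frac{\gamma_{t-1}^{(s)}}2\|z-z_{t-1}^{(s)}\|^2+\frac{\gamma_t^{(s)}-\gamma_{t-1}^{(s)}}2\|z-x_t^{(s)}\|^2\}$. At the end of epoch $s$: $u^{(s)}=\overline x_0^{(s+1)}=\overline x_{T_s}^{(s)}$, $z_0^{(s+1)}=z_{T_s}^{(s)}$, $g_0^{(s+1)}=g_{T_s}^{(s)}$, $\gamma_0^{(s+1)}=\gamma_{T_s}^{(s)}$. Output $u^{(S)}$. Counting. An evaluation of some $\nabla f_i$ at a point counts as one individual gradient evaluation; computing $\nabla f$ at a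 point counts as $n$. $\mathcal O(\cdot)$ hides absolute constants; iterated logarithms $\log\log(\cdot)$ inside $\mathcal O$ are read as $\max\{1,\log\log(\cdot)\}$ (and as $1$ when undefined). *)

theory Defs
  imports "HOL-Probability.Probability"
begin

text \<open>
  The dimension must be quantified inside the statement, after the absolute constant hidden in the
  O-notation, so it cannot be carried by a type. All spaces $R^d$ therefore live in one inner
  product space, that of finitely supported real sequences; \<open>Rd d\<close> below is the copy of $R^d$
  consisting of the sequences that vanish from index $d$ on.
\<close>

typedef finseq = "{x :: nat \<Rightarrow> real. finite {i. x i \<noteq> 0}}"
  morphisms coord Abs_finseq
  by (rule exI[of _ "\<lambda>_. 0"]) simp

setup_lifting type_definition_finseq

lemma finite_coord [simp]: "finite {i. coord x i \<noteq> 0}"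
  using coord[of x] by simp

lemma finseq_eqI: "(\<And>i. coord x i = coord y i) \<Longrightarrow> x = y"
  by (simp add: coord_inject[symmetric] fun_eq_iff)

instantiation finseq :: real_vector
begin

lift_definition zero_finseq :: finseq is "\<lambda>_. 0"
  by simp

lift_definition plus_finseq :: "finseq \<Rightarrow> finseq \<Rightarrow> finseq" is "\<lambda>x y i. x i + y i"
  subgoal for x y by (rule finite_subset[of _ "{i. x i \<noteq> 0} \<union> {i. y i \<noteq> 0}"]) auto
  done

lift_definition minus_finseq :: "finseq \<Rightarrow> finseq \<Rightarrow> finseq" is "\<lambda>x y i. x i - y i"
  subgoal for x y by (rule finite_subset[of _ "{i. x i \<noteq> 0} \<union> {i. y i \<noteq> 0}"]) auto
  done

lift_definition uminus_finseq :: "finseq \<Rightarrow> finseq" is "\<lambda>x i. - x i"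
  by simp

lift_definition scaleR_finseq :: "real \<Rightarrow> finseq \<Rightarrow> finseq" is "\<lambda>c x i. c * x i"
  by (rule finite_subset[rotated]) auto

instance
  by standard (transfer; simp add: fun_eq_iff algebra_simps)+

end

lemma coord_simps [simp]:
  "coord 0 i = 0"
  "coord (x + y) i = coord x i + coord y i"
  "coord (x - y) i = coord x i - coord y i"
  "coord (- x) i = - coord x i"
  "coord (c *\<^sub>R x) i = c * coord x i"
  by (transfer; simp)+

instantiation finseq :: real_inner
begin

definition inner_finseq :: "finseq \<Rightarrow> finseq \<Rightarrow> real" where
  "inner_finseq x y = (\<Sum>i | coord x i \<noteq> 0. coord x i * coord y i)"

definition norm_finseq :: "finseq \<Rightarrow> real" where
  "norm_finseq x = sqrt (inner x x)"

definition dist_finseq :: "finseq \<Rightarrow> finseq \<Rightarrow> real" where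
  "dist_finseq x y = norm (x - y)"

definition sgn_finseq :: "finseq \<Rightarrow> finseq" where
  "sgn_finseq x = x /\<^sub>R norm x"

definition uniformity_finseq :: "(finseq \<times> finseq) filter" where
  "uniformity_finseq = (INF e\<in>{0<..}. principal {(x, y). dist x y < e})"

definition open_finseq :: "finseq set \<Rightarrow> bool" where
  "open_finseq U \<longleftrightarrow> (\<forall>x\<in>U. eventually (\<lambda>(x', y). x' = x \<longrightarrow> y \<in> U) uniformity)"

lemma inner_finseq_superset:
  assumes "finite K" "{i. coord x i \<noteq> 0} \<subseteq> K"
  shows "inner x y = (\<Sum>i\<in>K. coord x i * coord y i)"
  unfolding inner_finseq_def using assms by (intro sum.mono_neutral_left) auto

instance
proof
  fix x y z :: finseq and r :: real
  let ?K = "{i. coord x i \<noteq> 0} \<union> {i. coord y i \<noteq> 0}"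
  have K: "finite ?K" by simp
  show "inner x y = inner y x"
    by (subst (1 2) inner_finseq_superset[OF K]) (auto simp: mult.commute)
  have "inner (x + y) z = (\<Sum>i\<in>?K. coord (x + y) i * coord z i)"
    by (intro inner_finseq_superset K) auto
  moreover have "inner x z = (\<Sum>i\<in>?K. coord x i * coord z i)"
    by (intro inner_finseq_superset K) auto
  moreover have "inner y z = (\<Sum>i\<in>?K. coord y i * coord z i)"
    by (intro inner_finseq_superset K) auto
  ultimately show "inner (x + y) z = inner x z + inner y z"
    by (simp add: sum.distrib distrib_right)
  have "inner (r *\<^sub>R x) y = (\<Sum>i\<in>?K. coord (r *\<^sub>R x) i * coord y i)"
    by (intro inner_finseq_superset K) auto
  moreover have "inner x y = (\<Sum>i\<in>?K. coord x i * coord y i)"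
    by (intro inner_finseq_superset K) auto
  ultimately show "inner (r *\<^sub>R x) y = r * inner x y"
    by (simp add: sum_distrib_left mult.assoc)
  show "0 \<le> inner x x"
    unfolding inner_finseq_def by (intro sum_nonneg) simp
  show "inner x x = 0 \<longleftrightarrow> x = 0"
  proof
    assume "inner x x = 0"
    hence "\<forall>i\<in>{i. coord x i \<noteq> 0}. coord x i * coord x i = 0"
      unfolding inner_finseq_def by (subst (asm) sum_nonneg_eq_0_iff) auto
    thus "x = 0" by (intro finseq_eqI) auto
  next
    assume "x = 0"
    thus "inner x x = 0" unfolding inner_finseq_def by simp
  qed
qed (rule norm_finseq_def dist_finseq_def sgn_finseq_def uniformity_finseq_def open_finseq_def)+

end

definition Rd :: "nat \<Rightarrow> finseq set" where
  "Rd d = {x. \<forall>i\<ge>d. coord x i = 0}"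

lemma subspace_Rd: "subspace (Rd d)"
  by (auto simp: subspace_def Rd_def)

lemma inner_Rd: "x \<in> Rd d \<Longrightarrow> inner x y = (\<Sum>i<d. coord x i * coord y i)"
  by (intro inner_finseq_superset) (auto simp: Rd_def not_le[symmetric])

lemma norm_Rd: "x \<in> Rd d \<Longrightarrow> norm x = sqrt (\<Sum>i<d. (coord x i)\<^sup>2)"
  by (simp add: norm_eq_sqrt_inner inner_Rd power2_eq_square)

lemma Rd_surj: "\<exists>x\<in>Rd d. \<forall>i<d. coord x i = w i"
proof -
  have "finite {i. (if i < d then w i else (0::real)) \<noteq> 0}"
    by (rule finite_subset[of _ "{..<d}"]) auto
  hence "coord (Abs_finseq (\<lambda>i. if i < d then w i else 0)) = (\<lambda>i. if i < d then w i else 0)"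
    by (simp add: Abs_finseq_inverse)
  thus ?thesis
    by (intro bexI[of _ "Abs_finseq (\<lambda>i. if i < d then w i else 0)"]) (auto simp: Rd_def)
qed

definition grad :: "nat \<Rightarrow> (finseq \<Rightarrow> real) \<Rightarrow> finseq \<Rightarrow> finseq" where
  "grad d f x = (THE g. g \<in> Rd d \<and> (f has_derivative (\<lambda>v. inner g v)) (at x within Rd d))"

definition average :: "nat \<Rightarrow> (nat \<Rightarrow> finseq \<Rightarrow> real) \<Rightarrow> finseq \<Rightarrow> real" where
  "average n f x = (1 / real n) * (\<Sum>i = 1..n. f i x)"

text \<open>
  The fields are the current values of $\overline x_t^{(s)}$, $z_t^{(s)}$, $g_t^{(s)}$,
  $\gamma_t^{(s)}$, $A_t^{(s)}$ and the number of individual gradient evaluations made so far.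
  Between epochs, \<open>xbar\<close> is $u^{(s)}$.
\<close>

record vstate =
  xbar :: finseq
  zpt :: finseq
  gest :: finseq
  gam :: real
  wgt :: real
  evals :: nat

text \<open>
  Gradient estimate at \<open>y\<close> in iteration \<open>t\<close> of an epoch of length \<open>T\<close> with anchor \<open>u\<close>, with its
  cost. The full gradient at the anchor is $g_0^{(s)}$: it was computed, and its $n$ evaluations
  were counted, before the epoch started.
\<close>

definition estimate ::
  "nat \<Rightarrow> nat \<Rightarrow> (nat \<Rightarrow> finseq \<Rightarrow> real) \<Rightarrow> nat \<Rightarrow> nat \<Rightarrow> finseq \<Rightarrow> finseq \<Rightarrow> (finseq \<times> nat) pmf" where
  "estimate d n f T t u y =
    (if t \<noteq> T
     then map_pmf (\<lambda>i. (grad d (f i) y - grad d (f i) u + grad d (average n f) u, 2))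
            (pmf_of_set {1..n})
     else return_pmf (grad d (average n f) y, n))"

definition iteration ::
  "nat \<Rightarrow> nat \<Rightarrow> finseq set \<Rightarrow> (nat \<Rightarrow> finseq \<Rightarrow> real) \<Rightarrow> (finseq \<Rightarrow> real) \<Rightarrow> real \<Rightarrow>
    real \<Rightarrow> nat \<Rightarrow> finseq \<Rightarrow> nat \<Rightarrow> vstate \<Rightarrow> vstate pmf" where
  "iteration d n X f h \<eta> a T u t st =
    (let x = arg_min_on (\<lambda>x. a * inner (gest st) x + a * h x
                             + gam st / 2 * (norm (x - zpt st))\<^sup>2) X;
         A' = wgt st + a + a\<^sup>2;
         y = (1 / A') *\<^sub>R (wgt st *\<^sub>R xbar st + a *\<^sub>R x + a\<^sup>2 *\<^sub>R u)
     in do {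
       (g', k) \<leftarrow> estimate d n f T t u y;
       let \<gamma>' = (1 / \<eta>) * sqrt (\<eta>\<^sup>2 * (gam st)\<^sup>2 + a\<^sup>2 * (norm (g' - gest st))\<^sup>2);
       let z' = arg_min_on (\<lambda>z. a * inner g' z + a * h z
                                + gam st / 2 * (norm (z - zpt st))\<^sup>2
                                + (\<gamma>' - gam st) / 2 * (norm (z - x))\<^sup>2) X;
       return_pmf \<lparr>xbar = y, zpt = z', gest = g', gam = \<gamma>', wgt = A', evals = evals st + k\<rparr>
     })"

primrec iterations ::
  "nat \<Rightarrow> nat \<Rightarrow> finseq set \<Rightarrow> (nat \<Rightarrow> finseq \<Rightarrow> real) \<Rightarrow> (finseq \<Rightarrow> real) \<Rightarrow> real \<Rightarrow>
    real \<Rightarrow> nat \<Rightarrow> finseq \<Rightarrow> nat \<Rightarrow> vstate \<Rightarrow> vstate pmf" where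
  "iterations d n X f h \<eta> a T u 0 st = return_pmf st"
| "iterations d n X f h \<eta> a T u (Suc t) st =
    iterations d n X f h \<eta> a T u t st \<bind> iteration d n X f h \<eta> a T u (Suc t)"

definition epoch ::
  "nat \<Rightarrow> nat \<Rightarrow> finseq set \<Rightarrow> (nat \<Rightarrow> finseq \<Rightarrow> real) \<Rightarrow> (finseq \<Rightarrow> real) \<Rightarrow> real \<Rightarrow>
    real \<Rightarrow> nat \<Rightarrow> vstate \<Rightarrow> vstate pmf" where
  "epoch d n X f h \<eta> a T st =
    iterations d n X f h \<eta> a T (xbar st) T (st\<lparr>wgt := wgt st - real T * a\<^sup>2\<rparr>)"

text \<open>
  Joint law of the state after \<open>S\<close> epochs; \<open>A0\<close> is $A_{T_0}^{(0)}$ and the index of \<open>a\<close>, \<open>T\<close> is the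
  epoch number $s \ge 1$. The output $u^{(S)}$ is the \<open>xbar\<close> component.
\<close>

primrec AdaVRAE ::
  "nat \<Rightarrow> nat \<Rightarrow> finseq set \<Rightarrow> (nat \<Rightarrow> finseq \<Rightarrow> real) \<Rightarrow> (finseq \<Rightarrow> real) \<Rightarrow> (nat \<Rightarrow> real) \<Rightarrow>
    (nat \<Rightarrow> nat) \<Rightarrow> real \<Rightarrow> real \<Rightarrow> real \<Rightarrow> finseq \<Rightarrow> nat \<Rightarrow> vstate pmf" where
  "AdaVRAE d n X f h a T A0 \<eta> \<gamma> u0 0 =
    return_pmf \<lparr>xbar = u0, zpt = u0, gest = grad d (average n f) u0, gam = \<gamma>, wgt = A0, evals = n\<rparr>"
| "AdaVRAE d n X f h a T A0 \<eta> \<gamma> u0 (Suc s) =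
    AdaVRAE d n X f h a T A0 \<eta> \<gamma> u0 s \<bind> epoch d n X f h \<eta> (a (Suc s)) (T (Suc s))"

definition s_zero :: "nat \<Rightarrow> nat" where
  "s_zero n = nat \<lceil>log 2 (log 2 (4 * real n))\<rceil>"

definition step_size :: "nat \<Rightarrow> nat \<Rightarrow> real" where
  "step_size n s =
    (let c = 3 / 2
     in if s \<le> s_zero n then (4 * real n) powr (- ((1 / 2) ^ s))
        else (real s - real (s_zero n) - 1 + c) / (2 * c))"

text \<open>The convention for $\log\log$ inside $O$: at least 1, and 1 where it is undefined.\<close>

definition loglog :: "real \<Rightarrow> real" where
  "loglog x = (if x > 1 then max 1 (ln (ln x)) else 1)"

end

theory Submission
  imports Defs
begin

text \<open>
  Along every run, the extragradient step bounds the increase of the weighted suboptimality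
  A_t (F(xbar_t) - F*) up to terms of three kinds: Bregman divergences, which come with a negative
  sign, the zero-mean error of the gradient estimate, and (D^2/2 + eta^2) times the growth of gamma_t.
  Since eta^2 (gamma_t^2 - gamma_{t-1}^2) = a^2 |g_t - g_{t-1}|^2, adding a small multiple of
  gamma_t^2 to the potential pays for the linear growth of gamma_t, while cocoercivity and variance
  reduction bound its expected increase by the Bregman divergences. The resulting potential is a
  supermartingale, so A E[F(u) - F*] <= V for the deterministic final weight A. For the given step
  sizes, this weight is of order n after s_0 epochs and then grows as n times the square of the number
  of further epochs.
\<close>

section \<open>Gradients on the coordinate subspaces\<close>

text \<open>The parameter \<open>gam\<close> is random and depends on the very estimate whose error
  is averaged, so its growth cannot be pulled out of the expectation as a constant. With its square
  in the potential, each step needs only an inequality for a fixed past. The quadratic in the growth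
  of \<open>gam\<close> is minimised once, at the end; its minimum -6 \<beta> K^2 / \<eta>^2 is what
  the last summand of V pays for. The error has zero mean against the extragradient point because
  that point is computed before the index is drawn. A difference of consecutive estimates also
  contains the old error, which no divergence of the current step controls; it is stored in the
  potential, and this store is empty between epochs, where the estimate is the exact gradient. What
  remains to be required of the parameters is that every epoch starts, after the deduction of T a^2,
  with weight at least a^2/4. The early steps meet this because each is the square root of the one
  before.\<close>

lemma coord_sum: "coord (\<Sum>i\<in>I. g i) j = (\<Sum>i\<in>I. coord (g i) j)"
  by (induction I rule: infinite_finite_induct) auto

lemma Rd_closed [intro]:
  "0 \<in> Rd d"
  "x \<in> Rd d \<Longrightarrow> y \<in> Rd d \<Longrightarrow> x + y \<in> Rd d"
  "x \<in> Rd d \<Longrightarrow> y \<in> Rd d \<Longrightarrow> x - y \<in> Rd d"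
  "x \<in> Rd d \<Longrightarrow> c *\<^sub>R x \<in> Rd d"
  by (auto simp: Rd_def)

lemma sum_Rd: "(\<And>i. i \<in> I \<Longrightarrow> g i \<in> Rd d) \<Longrightarrow> (\<Sum>i\<in>I. g i) \<in> Rd d"
  using subspace_sum[OF subspace_Rd] by blast

text \<open>Finitely supported sequences do not form a complete space, so the representing vector
  comes from the finite dimension of \<open>Rd d\<close>: its coordinates are the values of
  \<open>L\<close> at unit vectors.\<close>

lemma linear_functional_Rd:
  assumes "linear (L :: finseq \<Rightarrow> real)"
  obtains g where "g \<in> Rd d" "\<And>v. v \<in> Rd d \<Longrightarrow> L v = inner g v"
proof -
  have "\<forall>i. \<exists>e. e \<in> Rd d \<and> (\<forall>j<d. coord e j = (if j = i then 1 else 0))"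
    using Rd_surj[of d "\<lambda>j. if j = i then 1 else 0" for i] by blast
  then obtain e where e: "\<And>i. e i \<in> Rd d"
      "\<And>i j. j < d \<Longrightarrow> coord (e i) j = (if j = i then 1 else 0)"
    by metis
  obtain g where g: "g \<in> Rd d" "\<And>i. i < d \<Longrightarrow> coord g i = L (e i)"
    using Rd_surj by meson
  show ?thesis
  proof (rule that[OF g(1)])
    fix v assume v: "v \<in> Rd d"
    have "v = (\<Sum>i<d. coord v i *\<^sub>R e i)"
    proof (rule finseq_eqI)
      fix j
      show "coord v j = coord (\<Sum>i<d. coord v i *\<^sub>R e i) j"
      proof (cases "j < d")
        case True
        then show ?thesis by (simp add: coord_sum e(2) if_distrib cong: if_cong)
      next
        case False
        then show ?thesis using v e(1) by (simp add: coord_sum Rd_def)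
      qed
    qed
    then have "L v = L (\<Sum>i<d. coord v i *\<^sub>R e i)" by simp
    also have "\<dots> = (\<Sum>i<d. coord v i * L (e i))"
      using assms by (simp add: linear_sum linear_cmul)
    also have "\<dots> = inner g v"
      by (simp add: inner_Rd[OF g(1)] g(2) mult.commute)
    finally show "L v = inner g v" .
  qed
qed

text \<open>The whole line stays in \<open>Rd d\<close>, so a derivative relative to
  \<open>Rd d\<close> restricts to an ordinary derivative in one real variable.\<close>

lemma has_derivative_along_line:
  assumes "(f has_derivative inner g) (at (x + t *\<^sub>R v) within Rd d)" "x \<in> Rd d" "v \<in> Rd d"
  shows "((\<lambda>t. f (x + t *\<^sub>R v)) has_real_derivative inner g v) (at t)"
proof -
  have "((\<lambda>t. x + t *\<^sub>R v) has_derivative (\<lambda>t. t *\<^sub>R v)) (at t)"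
    by (auto intro!: derivative_eq_intros)
  moreover have "(f has_derivative inner g) (at (x + t *\<^sub>R v) within range (\<lambda>t. x + t *\<^sub>R v))"
    by (rule has_derivative_subset[OF assms(1)]) (use assms in auto)
  ultimately have "((\<lambda>t. f (x + t *\<^sub>R v)) has_derivative (\<lambda>t. inner g (t *\<^sub>R v))) (at t)"
    by (rule has_derivative_in_compose)
  then show ?thesis
    by (rule has_derivative_imp_has_field_derivative) simp
qed

text \<open>Both candidates are tested along their own difference, which is a direction in
  \<open>Rd d\<close>. This is what gives \<open>grad\<close>, a definite description, its
  meaning.\<close>

lemma gradient_unique:
  assumes "(f has_derivative inner g) (at x within Rd d)"
    and "(f has_derivative inner g') (at x within Rd d)"
    and "g \<in> Rd d" "g' \<in> Rd d" "x \<in> Rd d"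
  shows "g = g'"
proof -
  have "g - g' \<in> Rd d" using assms by auto
  then have "((\<lambda>t. f (x + t *\<^sub>R (g - g'))) has_real_derivative inner g (g - g')) (at 0)"
    and "((\<lambda>t. f (x + t *\<^sub>R (g - g'))) has_real_derivative inner g' (g - g')) (at 0)"
    using assms by (auto intro!: has_derivative_along_line[where d = d])
  then have "inner (g - g') (g - g') = 0"
    using DERIV_unique by (fastforce simp: inner_diff_left)
  then show ?thesis by simp
qed

lemma grad_eqI:
  assumes "(f has_derivative inner g) (at x within Rd d)" "g \<in> Rd d" "x \<in> Rd d"
  shows "grad d f x = g"
  unfolding grad_def using assms gradient_unique by (intro the_equality) blast+

text \<open>The derivative is a functional on all finite sequences and agrees with an inner product
  only on \<open>Rd d\<close>; difference quotients within \<open>Rd d\<close> see no other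
  directions.\<close>

lemma
  assumes "f differentiable_on Rd d" "x \<in> Rd d"
  shows grad_in_Rd: "grad d f x \<in> Rd d"
    and grad_has_derivative: "(f has_derivative inner (grad d f x)) (at x within Rd d)"
proof -
  obtain L where L: "(f has_derivative L) (at x within Rd d)"
    using assms by (auto simp: differentiable_on_def differentiable_def)
  then have "linear L"
    by (simp add: bounded_linear.linear has_derivative_bounded_linear)
  then obtain g where g: "g \<in> Rd d" "\<And>v. v \<in> Rd d \<Longrightarrow> L v = inner g v"
    using linear_functional_Rd by blast
  have "(f has_derivative inner g) (at x within Rd d)"
    unfolding has_derivative_within'
  proof (intro conjI allI impI)
    show "bounded_linear (inner g)" by (rule bounded_linear_inner_right)
    fix e :: real assume "e > 0"
    then obtain r where "r > 0" and
      r: "\<And>y. y \<in> Rd d \<Longrightarrow> 0 < norm (y - x) \<Longrightarrow> norm (y - x) < r \<Longrightarrow>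
        norm (f y - f x - L (y - x)) / norm (y - x) < e"
      using L unfolding has_derivative_within' by blast
    show "\<exists>r>0. \<forall>y\<in>Rd d. 0 < norm (y - x) \<and> norm (y - x) < r \<longrightarrow>
        norm (f y - f x - inner g (y - x)) / norm (y - x) < e"
    proof (intro exI conjI ballI impI)
      fix y assume y: "y \<in> Rd d" "0 < norm (y - x) \<and> norm (y - x) < r"
      with assms(2) have "y - x \<in> Rd d" by auto
      then show "norm (f y - f x - inner g (y - x)) / norm (y - x) < e"
        using r[of y] y g(2) by simp
    qed fact
  qed
  with g(1) assms(2) grad_eqI show "grad d f x \<in> Rd d"
    "(f has_derivative inner (grad d f x)) (at x within Rd d)"
    by auto
qed

definition bregman :: "nat \<Rightarrow> (finseq \<Rightarrow> real) \<Rightarrow> finseq \<Rightarrow> finseq \<Rightarrow> real" where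
  "bregman d f y x = f y - f x - inner (grad d f x) (y - x)"

text \<open>On the segment from \<open>x\<close> to \<open>y\<close> this is the tangent inequality
  for a convex function of one variable.\<close>

lemma bregman_nonneg:
  assumes "convex_on (Rd d) f" "f differentiable_on Rd d" "x \<in> Rd d" "y \<in> Rd d"
  shows "0 \<le> bregman d f y x"
proof -
  let ?p = "\<lambda>t. f (x + t *\<^sub>R (y - x))"
  have v: "y - x \<in> Rd d" using assms by auto
  have "convex_on UNIV ?p"
  proof (intro convex_onI)
    fix t s1 s2 :: real assume t: "0 < t" "t < 1"
    have "x + ((1 - t) *\<^sub>R s1 + t *\<^sub>R s2) *\<^sub>R (y - x)
        = (1 - t) *\<^sub>R (x + s1 *\<^sub>R (y - x)) + t *\<^sub>R (x + s2 *\<^sub>R (y - x))"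
      by (simp add: algebra_simps)
    then show "?p ((1 - t) *\<^sub>R s1 + t *\<^sub>R s2) \<le> (1 - t) * ?p s1 + t * ?p s2"
      using convex_onD[OF assms(1), of t "x + s1 *\<^sub>R (y - x)" "x + s2 *\<^sub>R (y - x)"] t v assms
      by auto
  qed simp
  moreover have "(?p has_real_derivative inner (grad d f x) (y - x)) (at 0)"
    using grad_has_derivative[OF assms(2,3)] assms(3) v
    by (intro has_derivative_along_line[where d = d]) auto
  ultimately have "inner (grad d f x) (y - x) * (1 - 0) \<le> ?p 1 - ?p 0"
    by (intro convex_on_imp_above_tangent[where A = UNIV]) auto
  then show ?thesis by (simp add: bregman_def)
qed

text \<open>Along the segment, the excess over the quadratic model is a function \<open>?q\<close>
  whose derivative is nonpositive by Cauchy-Schwarz and the Lipschitz bound; no integral of the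
  gradient is taken.\<close>

lemma bregman_le_smooth:
  assumes "f differentiable_on Rd d" "x \<in> Rd d" "y \<in> Rd d"
    and lip: "\<And>x y. x \<in> Rd d \<Longrightarrow> y \<in> Rd d \<Longrightarrow> norm (grad d f x - grad d f y) \<le> \<beta> * norm (x - y)"
  shows "bregman d f y x \<le> \<beta> / 2 * (norm (y - x))\<^sup>2"
proof -
  define v where "v = y - x"
  have v: "v \<in> Rd d" using assms v_def by auto
  let ?q = "\<lambda>t. f (x + t *\<^sub>R v) - t * inner (grad d f x) v - \<beta> / 2 * t\<^sup>2 * (norm v)\<^sup>2"
  have "?q 1 \<le> ?q 0"
  proof (rule DERIV_nonpos_imp_nonincreasing[of 0 1])
    fix t :: real assume t: "0 \<le> t" "t \<le> 1"
    have xt: "x + t *\<^sub>R v \<in> Rd d" using assms v by auto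
    have "((\<lambda>t. f (x + t *\<^sub>R v)) has_real_derivative inner (grad d f (x + t *\<^sub>R v)) v) (at t)"
      using grad_has_derivative[OF assms(1) xt] assms(2) v by (rule has_derivative_along_line)
    then have "(?q has_real_derivative
        inner (grad d f (x + t *\<^sub>R v)) v - inner (grad d f x) v - \<beta> * t * (norm v)\<^sup>2) (at t)"
      by (auto intro!: derivative_eq_intros)
    moreover have "inner (grad d f (x + t *\<^sub>R v) - grad d f x) v \<le> \<beta> * t * (norm v)\<^sup>2"
    proof -
      have "inner (grad d f (x + t *\<^sub>R v) - grad d f x) v
          \<le> norm (grad d f (x + t *\<^sub>R v) - grad d f x) * norm v"
        by (rule norm_cauchy_schwarz)
      also have "\<dots> \<le> \<beta> * norm (x + t *\<^sub>R v - x) * norm v"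
        using xt assms by (intro mult_right_mono lip) auto
      finally show ?thesis using t by (simp add: power2_eq_square)
    qed
    ultimately show "\<exists>z. (?q has_real_derivative z) (at t) \<and> z \<le> 0"
      by (force simp: inner_diff_left)
  qed simp
  then show ?thesis by (simp add: bregman_def v_def)
qed

text \<open>Minimise the upper quadratic model of \<open>bregman d f _ x\<close> at \<open>y\<close>: the minimal value is
  nonnegative.\<close>
lemma grad_diff_le_bregman:
  assumes "convex_on (Rd d) f" "f differentiable_on Rd d" "x \<in> Rd d" "y \<in> Rd d" "\<beta> > 0"
    and lip: "\<And>x y. x \<in> Rd d \<Longrightarrow> y \<in> Rd d \<Longrightarrow> norm (grad d f x - grad d f y) \<le> \<beta> * norm (x - y)"
  shows "(norm (grad d f y - grad d f x))\<^sup>2 \<le> 2 * \<beta> * bregman d f y x"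
proof -
  define e where "e = grad d f y - grad d f x"
  define w where "w = y - (1 / \<beta>) *\<^sub>R e"
  have "e \<in> Rd d" unfolding e_def using grad_in_Rd assms by blast
  then have w: "w \<in> Rd d" unfolding w_def using assms by auto
  have "0 \<le> bregman d f w x" by (rule bregman_nonneg) fact+
  also have "\<dots> = bregman d f w y + bregman d f y x + inner e (w - y)"
    by (simp add: bregman_def e_def algebra_simps)
  also have "\<dots> \<le> \<beta> / 2 * (norm (w - y))\<^sup>2 + bregman d f y x + inner e (w - y)"
    using bregman_le_smooth[OF assms(2) \<open>y \<in> Rd d\<close> w lip] by simp
  also have "\<dots> = bregman d f y x - (norm e)\<^sup>2 / (2 * \<beta>)"
    using assms(5) unfolding w_def
    by (simp add: power2_norm_eq_inner[symmetric] power_mult_distrib)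
       (simp add: field_simps power2_eq_square)
  finally show ?thesis using assms(5) by (simp add: e_def field_simps)
qed

lemma grad_average:
  assumes "\<And>i. i \<in> {1..n} \<Longrightarrow> f i differentiable_on Rd d" "x \<in> Rd d"
  shows "grad d (average n f) x = (1 / real n) *\<^sub>R (\<Sum>i = 1..n. grad d (f i) x)"
proof (rule grad_eqI)
  have "((\<lambda>x. (1 / real n) * (\<Sum>i = 1..n. f i x)) has_derivative
      (\<lambda>v. (1 / real n) * (\<Sum>i = 1..n. inner (grad d (f i) x) v))) (at x within Rd d)"
    using assms grad_has_derivative
    by (intro has_derivative_mult_right has_derivative_sum) auto
  then show "(average n f has_derivative inner ((1 / real n) *\<^sub>R (\<Sum>i = 1..n. grad d (f i) x)))
      (at x within Rd d)"
    by (simp add: average_def[abs_def] inner_sum_left[abs_def] inner_scaleR_left[abs_def])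
  show "(1 / real n) *\<^sub>R (\<Sum>i = 1..n. grad d (f i) x) \<in> Rd d"
    using assms grad_in_Rd by (intro Rd_closed sum_Rd) auto
qed fact

lemma bregman_average:
  assumes "\<And>i. i \<in> {1..n} \<Longrightarrow> f i differentiable_on Rd d" "x \<in> Rd d"
  shows "bregman d (average n f) y x = (1 / real n) * (\<Sum>i = 1..n. bregman d (f i) y x)"
  unfolding bregman_def using grad_average[OF assms]
  by (simp add: average_def sum_subtractf inner_sum_left right_diff_distrib)

section \<open>Proximal steps\<close>

lemma norm_convex_combination:
  fixes x y p :: "'a::real_inner"
  shows "(norm ((1 - t) *\<^sub>R x + t *\<^sub>R y - p))\<^sup>2
    = (1 - t) * (norm (x - p))\<^sup>2 + t * (norm (y - p))\<^sup>2 - t * (1 - t) * (norm (x - y))\<^sup>2"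
  unfolding power2_norm_eq_inner
  by (simp add: inner_diff_left inner_diff_right inner_add_left inner_add_right inner_commute)
     (simp add: algebra_simps)

text \<open>The quadratic terms make the objective strongly convex with modulus
  \<open>c1 + c2\<close>. The minimiser is compared with points of the segment towards
  \<open>y\<close>, the comparison is divided by t, and t tends to 0. Only values of
  \<open>H\<close> on \<open>X\<close> enter, as \<open>H\<close> may be nonsmooth.\<close>

lemma prox_inequality:
  fixes x y :: "'a::real_inner"
  assumes "convex_on X H"
    and min: "is_arg_min (\<lambda>x. H x + c1 / 2 * (norm (x - p))\<^sup>2 + c2 / 2 * (norm (x - q))\<^sup>2)
      (\<lambda>x. x \<in> X) x"
    and "y \<in> X"
  shows "H x + c1 / 2 * (norm (x - p))\<^sup>2 + c2 / 2 * (norm (x - q))\<^sup>2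
      + (c1 + c2) / 2 * (norm (x - y))\<^sup>2
    \<le> H y + c1 / 2 * (norm (y - p))\<^sup>2 + c2 / 2 * (norm (y - q))\<^sup>2"
proof -
  let ?P = "\<lambda>x. H x + c1 / 2 * (norm (x - p))\<^sup>2 + c2 / 2 * (norm (x - q))\<^sup>2"
  define B where "B = (c1 + c2) / 2 * (norm (x - y))\<^sup>2"
  have x: "x \<in> X" and le: "\<And>z. z \<in> X \<Longrightarrow> ?P x \<le> ?P z"
    using min by (force simp: is_arg_min_linorder)+
  have *: "?P x + (1 - t) * B \<le> ?P y" if t: "0 < t" "t < 1" for t
  proof -
    let ?z = "(1 - t) *\<^sub>R x + t *\<^sub>R y"
    have "?z \<in> X"
      using convex_on_imp_convex[OF assms(1)] x \<open>y \<in> X\<close> t by (auto intro: convexD)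
    then have "?P x \<le> ?P ?z" by (rule le)
    also have "\<dots> \<le> (1 - t) * H x + t * H y
        + c1 / 2 * (norm (?z - p))\<^sup>2 + c2 / 2 * (norm (?z - q))\<^sup>2"
      using convex_onD[OF assms(1), of t x y] t x \<open>y \<in> X\<close> by simp
    also have "\<dots> = (1 - t) * ?P x + t * ?P y - t * ((1 - t) * B)"
      unfolding norm_convex_combination B_def by (simp add: field_simps)
    finally have "?P x \<le> (1 - t) * ?P x + t * ?P y - t * ((1 - t) * B)" .
    moreover have "t * (P + (1 - t) * B) \<le> t * Q" if "P \<le> (1 - t) * P + t * Q - t * ((1 - t) * B)" for P Q
      using that by (simp add: algebra_simps)
    ultimately have "t * (?P x + (1 - t) * B) \<le> t * ?P y" by blast
    then show ?thesis using t by simp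
  qed
  have "((\<lambda>t. ?P x + (1 - t) * B) \<longlongrightarrow> ?P x + (1 - 0) * B) (at_right 0)"
    by (intro tendsto_intros)
  moreover have "\<forall>\<^sub>F t in at_right 0. ?P x + (1 - t) * B \<le> ?P y"
    using eventually_at_right[of "0::real" 1] * by (auto simp: eventually_at_right_field intro!: exI[of _ 1] simp del: times_divide_eq_left)
  ultimately have "?P x + (1 - 0) * B \<le> ?P y"
    by (intro tendsto_upperbound) auto
  then show ?thesis by (simp add: B_def)
qed

section \<open>One iteration\<close>

lemma
  assumes "x \<in> X" "y \<in> X" "z \<in> X" "0 \<le> a" "0 \<le> b" "0 \<le> c" "a + b + c = (1::real)"
  shows convex_comb3: "convex X \<Longrightarrow> a *\<^sub>R x + b *\<^sub>R y + c *\<^sub>R z \<in> X"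
    and convex_on_comb3: "convex_on X h \<Longrightarrow> h (a *\<^sub>R x + b *\<^sub>R y + c *\<^sub>R z) \<le> a * h x + b * h y + c * h z"
proof -
  define p where "p i = (if i = 0 then x else if i = 1 then y else z)" for i :: nat
  define w where "w i = (if i = 0 then a else if i = 1 then b else c)" for i :: nat
  have *: "finite {0, 1, 2::nat}" "(\<Sum>i\<in>{0, 1, 2}. w i) = 1" "\<And>i. i \<in> {0, 1, 2} \<Longrightarrow> w i \<ge> 0"
    "\<And>i. i \<in> {0, 1, 2} \<Longrightarrow> p i \<in> X"
    using assms by (auto simp: p_def w_def)
  show "a *\<^sub>R x + b *\<^sub>R y + c *\<^sub>R z \<in> X" if "convex X"
    using convex_sum[where y = p, OF *(1) that *(2,3,4)] by (simp add: p_def w_def add.assoc)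
  show "h (a *\<^sub>R x + b *\<^sub>R y + c *\<^sub>R z) \<le> a * h x + b * h y + c * h z" if "convex_on X h"
    using convex_on_sum[where y = p, OF *(1) _ that *(2,3,4)] by (simp add: p_def w_def add.assoc)
qed

lemma norm_diff_scaleR_squared:
  fixes x y :: "'a::real_inner"
  shows "(norm (x - c *\<^sub>R y))\<^sup>2 = (norm x)\<^sup>2 - 2 * c * inner x y + c\<^sup>2 * (norm y)\<^sup>2"
  unfolding power2_norm_eq_inner
  by (simp add: inner_diff_left inner_diff_right inner_commute power2_eq_square algebra_simps)

lemma norm_sum3_squared_le:
  fixes x y z :: "'a::real_inner"
  shows "(norm (x + y + z))\<^sup>2 \<le> 3 * ((norm x)\<^sup>2 + (norm y)\<^sup>2 + (norm z)\<^sup>2)"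
proof -
  have "0 \<le> (norm (x - y))\<^sup>2 + (norm (y - z))\<^sup>2 + (norm (z - x))\<^sup>2" by simp
  then show ?thesis
    unfolding power2_norm_eq_inner
    by (simp add: inner_diff_left inner_diff_right inner_add_left inner_add_right inner_commute)
qed

lemma expectation_mono:
  fixes g g' :: "'a \<Rightarrow> real"
  assumes "finite (set_pmf p)" "\<And>x. x \<in> set_pmf p \<Longrightarrow> g x \<le> g' x"
  shows "measure_pmf.expectation p g \<le> measure_pmf.expectation p g'"
  using assms by (intro integral_mono_AE integrable_measure_pmf_finite) (auto simp: AE_measure_pmf_iff)

text \<open>The tower property as an inequality. Every draw has finite support, so expectations are
  finite sums and integrability is automatic.\<close>

lemma expectation_bind_le:
  fixes g :: "'b \<Rightarrow> real"
  assumes "finite (set_pmf p)" "\<And>x. x \<in> set_pmf p \<Longrightarrow> finite (set_pmf (q x))"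
    and "\<And>x. x \<in> set_pmf p \<Longrightarrow> measure_pmf.expectation (q x) g \<le> g' x"
  shows "measure_pmf.expectation (p \<bind> q) g \<le> measure_pmf.expectation p g'"
proof -
  have "measure_pmf.expectation (p \<bind> q) g
      = (\<Sum>x\<in>set_pmf p. pmf p x *\<^sub>R measure_pmf.expectation (q x) g)"
    using assms by (intro pmf_expectation_bind) auto
  also have "\<dots> \<le> (\<Sum>x\<in>set_pmf p. pmf p x *\<^sub>R g' x)"
    using assms by (intro sum_mono scaleR_left_mono) auto
  also have "\<dots> = measure_pmf.expectation p g'"
    using assms by (intro integral_measure_pmf[symmetric]) auto
  finally show ?thesis .
qed

text \<open>Here \<open>xstar\<close> is just a comparison point of \<open>X\<close>; its minimality
  enters in the final theorem, as F(xstar) \<le> F(u0). Minimisers of the subproblems are supplied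
  by \<open>prox_exists\<close>.\<close>

locale vr_extragradient =
  fixes d n :: nat and X :: "finseq set" and f :: "nat \<Rightarrow> finseq \<Rightarrow> real" and h :: "finseq \<Rightarrow> real"
    and \<beta> \<eta> D :: real and xstar :: finseq
  assumes n: "n \<ge> 1" and X: "X \<subseteq> Rd d" "convex X"
    and diam: "\<And>x y. x \<in> X \<Longrightarrow> y \<in> X \<Longrightarrow> norm (x - y) \<le> D"
    and \<beta>: "\<beta> > 0" and \<eta>: "\<eta> > 0"
    and f_convex: "\<And>i. i \<in> {1..n} \<Longrightarrow> convex_on (Rd d) (f i)"
    and f_diff: "\<And>i. i \<in> {1..n} \<Longrightarrow> f i differentiable_on Rd d"
    and f_smooth: "\<And>i x y. i \<in> {1..n} \<Longrightarrow> x \<in> Rd d \<Longrightarrow> y \<in> Rd d \<Longrightarrow>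
      norm (grad d (f i) x - grad d (f i) y) \<le> \<beta> * norm (x - y)"
    and h: "convex_on X h"
    and prox_exists: "\<And>l v. 0 \<le> l \<Longrightarrow> v \<in> Rd d \<Longrightarrow>
      \<exists>x. is_arg_min (\<lambda>x. l * h x + 1 / 2 * (norm (x - v))\<^sup>2) (\<lambda>x. x \<in> X) x"
    and xstar: "xstar \<in> X"
begin

abbreviation favg :: "finseq \<Rightarrow> real" where "favg \<equiv> average n f"
abbreviation Df :: "finseq \<Rightarrow> finseq" where "Df \<equiv> grad d favg"
abbreviation B :: "finseq \<Rightarrow> finseq \<Rightarrow> real" where "B \<equiv> bregman d favg"
abbreviation F :: "finseq \<Rightarrow> real" where "F x \<equiv> favg x + h x"

text \<open>The price per unit of growth of \<open>gam\<close> in \<open>regret\<close>: D^2/2 for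
  the quadratic centred at the extragradient point, \<eta>^2 for the change of the gradient
  estimate.\<close>

definition K :: real where "K = D\<^sup>2 / 2 + \<eta>\<^sup>2"

section \<open>The averaged objective and the variance of its gradient estimates\<close>

lemma in_Rd: "x \<in> X \<Longrightarrow> x \<in> Rd d"
  using X by blast

lemma Df_eq: "x \<in> Rd d \<Longrightarrow> Df x = (1 / real n) *\<^sub>R (\<Sum>i = 1..n. grad d (f i) x)"
  using f_diff by (rule grad_average)

lemma B_eq: "x \<in> Rd d \<Longrightarrow> B y x = (1 / real n) * (\<Sum>i = 1..n. bregman d (f i) y x)"
  using f_diff by (rule bregman_average)

lemma Df_in_Rd: "x \<in> Rd d \<Longrightarrow> Df x \<in> Rd d"
  using grad_in_Rd f_diff by (auto simp: Df_eq intro!: Rd_closed(4) sum_Rd)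

lemma B_nonneg: "x \<in> Rd d \<Longrightarrow> y \<in> Rd d \<Longrightarrow> 0 \<le> B y x"
  using bregman_nonneg f_convex f_diff by (auto simp: B_eq intro!: divide_nonneg_nonneg sum_nonneg)

lemma mean_grad_diff_le:
  assumes "x \<in> Rd d" "y \<in> Rd d"
  shows "(1 / real n) * (\<Sum>i = 1..n. (norm (grad d (f i) y - grad d (f i) x))\<^sup>2) \<le> 2 * \<beta> * B y x"
proof -
  have "(\<Sum>i = 1..n. (norm (grad d (f i) y - grad d (f i) x))\<^sup>2)
      \<le> (\<Sum>i = 1..n. 2 * \<beta> * bregman d (f i) y x)"
    using assms f_convex f_diff \<beta> f_smooth by (intro sum_mono grad_diff_le_bregman) auto
  then show ?thesis
    using n assms by (simp add: B_eq sum_distrib_left[symmetric] field_simps)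
qed

text \<open>The mean of the squared deviations from the mean is at most the mean of the squares.\<close>
lemma estimate_variance:
  assumes "u \<in> Rd d" "y \<in> Rd d"
  shows "(1 / real n) * (\<Sum>i = 1..n.
      (norm (grad d (f i) y - grad d (f i) u + Df u - Df y))\<^sup>2) \<le> 2 * \<beta> * B u y"
proof -
  define w where "w i = grad d (f i) u - grad d (f i) y" for i
  define m where "m = Df u - Df y"
  have "(\<Sum>i = 1..n. w i) = real n *\<^sub>R m"
    using n assms by (simp add: w_def m_def Df_eq sum_subtractf scaleR_diff_right)
  then have "(\<Sum>i = 1..n. inner m (w i)) = real n * (norm m)\<^sup>2"
    by (simp add: inner_sum_right[symmetric] power2_norm_eq_inner)
  moreover have "(norm (m - w i))\<^sup>2 = (norm (w i))\<^sup>2 + (norm m)\<^sup>2 - 2 * inner m (w i)" for i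
    by (simp add: power2_norm_eq_inner inner_diff_left inner_diff_right inner_commute)
  ultimately have "(\<Sum>i = 1..n. (norm (m - w i))\<^sup>2)
      = (\<Sum>i = 1..n. (norm (w i))\<^sup>2) - real n * (norm m)\<^sup>2"
    by (simp add: sum.distrib sum_subtractf sum_distrib_left[symmetric])
  also have "\<dots> \<le> (\<Sum>i = 1..n. (norm (w i))\<^sup>2)" by simp
  finally have "(1 / real n) * (\<Sum>i = 1..n. (norm (m - w i))\<^sup>2)
      \<le> (1 / real n) * (\<Sum>i = 1..n. (norm (w i))\<^sup>2)"
    by (intro mult_left_mono) auto
  also have "\<dots> \<le> 2 * \<beta> * B u y"
    unfolding w_def using assms by (intro mean_grad_diff_le)
  finally show ?thesis by (simp add: m_def w_def algebra_simps)
qed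

lemma estimate_unbiased:
  assumes "u \<in> Rd d" "y \<in> Rd d"
  shows "(\<Sum>i = 1..n. grad d (f i) y - grad d (f i) u + Df u - Df y) = 0"
  using n assms by (simp add: Df_eq sum.distrib sum_subtractf sum_constant_scaleR)

text \<open>The difference of full gradients is the mean of the component differences, so
  Cauchy-Schwarz reduces the claim to \<open>mean_grad_diff_le\<close>.\<close>

lemma Df_diff_le:
  assumes "x \<in> Rd d" "y \<in> Rd d"
  shows "(norm (Df y - Df x))\<^sup>2 \<le> 2 * \<beta> * B y x"
proof -
  define w where "w i = grad d (f i) y - grad d (f i) x" for i
  have "norm (\<Sum>i = 1..n. w i) \<le> (\<Sum>i = 1..n. norm (w i))"
    by (rule norm_sum)
  then have "(norm (\<Sum>i = 1..n. w i))\<^sup>2 \<le> (\<Sum>i = 1..n. norm (w i))\<^sup>2"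
    by (intro power_mono) auto
  also have "\<dots> \<le> real n * (\<Sum>i = 1..n. (norm (w i))\<^sup>2)"
    using sum_squared_le_sum_of_squares[of "\<lambda>i. norm (w i)" "{1..n}"] by (simp add: mult.commute)
  finally have "(norm (\<Sum>i = 1..n. w i))\<^sup>2 / (real n)\<^sup>2
      \<le> (1 / real n) * (\<Sum>i = 1..n. (norm (w i))\<^sup>2)"
    using n by (simp add: field_simps power2_eq_square)
  moreover have "Df y - Df x = (1 / real n) *\<^sub>R (\<Sum>i = 1..n. w i)"
    using assms by (simp add: w_def Df_eq sum_subtractf scaleR_diff_right)
  ultimately show ?thesis
    using mean_grad_diff_le[OF assms] by (simp add: w_def power_divide)
qed

text \<open>Completing the square turns the objective into a positive multiple of a plain proximal
  objective plus a constant. Hence a minimiser exists, and the choice made by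
  \<open>arg_min_on\<close> is one. Two centres are allowed so that both subproblems of an iteration
  are instances.\<close>

lemma prox_step:
  assumes "g \<in> Rd d" "p \<in> Rd d" "q \<in> Rd d" "a > 0" "c1 \<ge> 0" "c2 \<ge> 0" "c1 + c2 > 0"
    and x: "x = arg_min_on (\<lambda>x. a * inner g x + a * h x + c1 / 2 * (norm (x - p))\<^sup>2
      + c2 / 2 * (norm (x - q))\<^sup>2) X"
  shows "x \<in> X"
    and "y \<in> X \<Longrightarrow> a * inner g x + a * h x + c1 / 2 * (norm (x - p))\<^sup>2 + c2 / 2 * (norm (x - q))\<^sup>2
        + (c1 + c2) / 2 * (norm (x - y))\<^sup>2
      \<le> a * inner g y + a * h y + c1 / 2 * (norm (y - p))\<^sup>2 + c2 / 2 * (norm (y - q))\<^sup>2"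
proof -
  let ?H = "\<lambda>x. a * inner g x + a * h x"
  let ?P = "\<lambda>x. ?H x + c1 / 2 * (norm (x - p))\<^sup>2 + c2 / 2 * (norm (x - q))\<^sup>2"
  define c where "c = c1 + c2"
  have c: "c > 0" using assms c_def by simp
  \<comment> \<open>The minimiser of the linear and quadratic parts without \<open>h\<close>;
    \<open>C\<close> is the constant left by completing the square.\<close>
  define v where "v = (1 / c) *\<^sub>R (c1 *\<^sub>R p + c2 *\<^sub>R q - a *\<^sub>R g)"
  define C where "C = c1 / 2 * inner p p + c2 / 2 * inner q q - c / 2 * inner v v"
  have "v \<in> Rd d" unfolding v_def using assms by auto
  then obtain w where w: "is_arg_min (\<lambda>x. (a / c) * h x + 1 / 2 * (norm (x - v))\<^sup>2) (\<lambda>x. x \<in> X) w"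
    using prox_exists[of "a / c" v] assms c by auto
  have P: "?P x = c * ((a / c) * h x + 1 / 2 * (norm (x - v))\<^sup>2) + C" for x
  proof -
    have "c * inner x v = c1 * inner x p + c2 * inner x q - a * inner g x"
      using c by (simp add: v_def inner_diff_right inner_add_right inner_commute)
    moreover have norms: "(norm (x - v))\<^sup>2 = inner x x + inner v v - 2 * inner x v"
      "(norm (x - p))\<^sup>2 = inner x x + inner p p - 2 * inner x p"
      "(norm (x - q))\<^sup>2 = inner x x + inner q q - 2 * inner x q"
      by (simp_all add: power2_norm_eq_inner inner_diff_left inner_diff_right inner_commute)
    ultimately have "c1 / 2 * (norm (x - p))\<^sup>2 + c2 / 2 * (norm (x - q))\<^sup>2 + a * inner g x
        = c / 2 * (norm (x - v))\<^sup>2 + C"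
      unfolding norms C_def c_def by (simp add: field_simps)
    then show ?thesis using c by (simp add: field_simps)
  qed
  have "is_arg_min ?P (\<lambda>x. x \<in> X) w"
    using w c unfolding P is_arg_min_linorder by auto
  then have min: "is_arg_min ?P (\<lambda>x. x \<in> X) x"
    unfolding x arg_min_on_def arg_min_def by (rule someI)
  then show "x \<in> X" by (simp add: is_arg_min_def)
  have "convex_on X (\<lambda>x. inner g x)"
    using X(2) by (auto intro!: convex_onI simp: inner_add_right)
  then have "convex_on X ?H"
    using h assms by (intro convex_on_add convex_on_cmul) auto
  then show "?P x + (c1 + c2) / 2 * (norm (x - y))\<^sup>2 \<le> ?P y" if "y \<in> X"
    using min that by (rule prox_inequality)
qed

text \<open>The iteration is cut according to its dependence on the draw: \<open>extrapoint\<close>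
  and \<open>avgpoint\<close> are functions of the old state, and only \<open>nextgam\<close> and
  \<open>nextz\<close> see the new estimate.\<close>

definition extrapoint :: "real \<Rightarrow> vstate \<Rightarrow> finseq" where
  "extrapoint a st = arg_min_on (\<lambda>x. a * inner (gest st) x + a * h x
    + gam st / 2 * (norm (x - zpt st))\<^sup>2) X"

definition avgpoint :: "real \<Rightarrow> finseq \<Rightarrow> vstate \<Rightarrow> finseq" where
  "avgpoint a u st = (1 / (wgt st + a + a\<^sup>2)) *\<^sub>R
    (wgt st *\<^sub>R xbar st + a *\<^sub>R extrapoint a st + a\<^sup>2 *\<^sub>R u)"

definition nextgam :: "real \<Rightarrow> vstate \<Rightarrow> finseq \<Rightarrow> real" where
  "nextgam a st g' = (1 / \<eta>) * sqrt (\<eta>\<^sup>2 * (gam st)\<^sup>2 + a\<^sup>2 * (norm (g' - gest st))\<^sup>2)"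

definition nextz :: "real \<Rightarrow> vstate \<Rightarrow> finseq \<Rightarrow> finseq" where
  "nextz a st g' = arg_min_on (\<lambda>z. a * inner g' z + a * h z
    + gam st / 2 * (norm (z - zpt st))\<^sup>2
    + (nextgam a st g' - gam st) / 2 * (norm (z - extrapoint a st))\<^sup>2) X"

definition nextstate :: "real \<Rightarrow> finseq \<Rightarrow> vstate \<Rightarrow> finseq \<times> nat \<Rightarrow> vstate" where
  "nextstate a u st e = \<lparr>xbar = avgpoint a u st, zpt = nextz a st (fst e), gest = fst e,
    gam = nextgam a st (fst e), wgt = wgt st + a + a\<^sup>2, evals = evals st + snd e\<rparr>"

lemma iteration_eq:
  "iteration d n X f h \<eta> a T u t st =
    map_pmf (nextstate a u st) (estimate d n f T t u (avgpoint a u st))"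
  by (simp add: iteration_def map_pmf_def nextstate_def extrapoint_def avgpoint_def nextz_def
      nextgam_def Let_def case_prod_unfold)

section \<open>Inequalities for the extragradient step\<close>

definition valid :: "vstate \<Rightarrow> bool" where
  "valid st \<longleftrightarrow> xbar st \<in> X \<and> zpt st \<in> X \<and> gest st \<in> Rd d \<and> gam st > 0"

text \<open>This subproblem has one centre, so \<open>prox_step\<close> is used with
  \<open>c2 = 0\<close> and a dummy second centre.\<close>

lemma extrapoint:
  assumes "valid st" "a > 0"
  shows extrapoint_in: "extrapoint a st \<in> X"
    and extrapoint_le: "y \<in> X \<Longrightarrow> a * inner (gest st) (extrapoint a st) + a * h (extrapoint a st)
        + gam st / 2 * (norm (extrapoint a st - zpt st))\<^sup>2
        + gam st / 2 * (norm (extrapoint a st - y))\<^sup>2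
      \<le> a * inner (gest st) y + a * h y + gam st / 2 * (norm (y - zpt st))\<^sup>2"
  using prox_step(1)[of "gest st" "zpt st" "zpt st" a "gam st" 0 "extrapoint a st"]
    prox_step(2)[of "gest st" "zpt st" "zpt st" a "gam st" 0 "extrapoint a st" y] assms in_Rd
  by (simp_all add: valid_def extrapoint_def)

lemma
  assumes "valid st" "a > 0"
  shows nextgam_ge: "gam st \<le> nextgam a st g'"
    and nextgam_sq: "\<eta>\<^sup>2 * ((nextgam a st g')\<^sup>2 - (gam st)\<^sup>2) = a\<^sup>2 * (norm (g' - gest st))\<^sup>2"
proof -
  have g: "gam st > 0" using assms by (simp add: valid_def)
  have "gam st = (1 / \<eta>) * sqrt (\<eta>\<^sup>2 * (gam st)\<^sup>2)"
    using g \<eta> by (simp add: real_sqrt_mult)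
  also have "\<dots> \<le> nextgam a st g'"
    unfolding nextgam_def using \<eta> by (intro mult_left_mono real_sqrt_le_mono) auto
  finally show "gam st \<le> nextgam a st g'" .
  have "\<eta>\<^sup>2 * (nextgam a st g')\<^sup>2 = \<eta>\<^sup>2 * (gam st)\<^sup>2 + a\<^sup>2 * (norm (g' - gest st))\<^sup>2"
    using \<eta> by (simp add: nextgam_def power_mult_distrib power_divide)
  then show "\<eta>\<^sup>2 * ((nextgam a st g')\<^sup>2 - (gam st)\<^sup>2) = a\<^sup>2 * (norm (g' - gest st))\<^sup>2"
    by (simp add: algebra_simps)
qed

lemma nextz:
  assumes "valid st" "a > 0" "g' \<in> Rd d"
  shows nextz_in: "nextz a st g' \<in> X"
    and nextz_le: "y \<in> X \<Longrightarrow> a * inner g' (nextz a st g') + a * h (nextz a st g')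
        + gam st / 2 * (norm (nextz a st g' - zpt st))\<^sup>2
        + (nextgam a st g' - gam st) / 2 * (norm (nextz a st g' - extrapoint a st))\<^sup>2
        + nextgam a st g' / 2 * (norm (nextz a st g' - y))\<^sup>2
      \<le> a * inner g' y + a * h y + gam st / 2 * (norm (y - zpt st))\<^sup>2
        + (nextgam a st g' - gam st) / 2 * (norm (y - extrapoint a st))\<^sup>2"
  using prox_step(1)[of g' "zpt st" "extrapoint a st" a "gam st" "nextgam a st g' - gam st"
      "nextz a st g'"]
    prox_step(2)[of g' "zpt st" "extrapoint a st" a "gam st" "nextgam a st g' - gam st"
      "nextz a st g'" y] assms in_Rd extrapoint_in[of st a] nextgam_ge[of st a g']
  by (simp_all add: valid_def nextz_def)

text \<open>The second subproblem is compared with \<open>y\<close>, the first with the solution z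
  of the second. Their terms in |x - z|^2 add up to half the new \<open>gam\<close> times |x - z|^2,
  which absorbs the inner product of x - z with the change of the estimate. The update rule of
  \<open>gam\<close> turns what is left into linear growth of \<open>gam\<close>.\<close>

lemma regret:
  assumes st: "valid st" and a: "a > 0" and g': "g' \<in> Rd d" and y: "y \<in> X"
  shows "a * inner g' (extrapoint a st - y) + a * (h (extrapoint a st) - h y)
    \<le> gam st / 2 * (norm (zpt st - y))\<^sup>2 - nextgam a st g' / 2 * (norm (nextz a st g' - y))\<^sup>2
      + K * (nextgam a st g' - gam st)"
proof -
  define x where "x = extrapoint a st"
  define z where "z = nextz a st g'"
  define c where "c = gam st"
  define c' where "c' = nextgam a st g'"
  define e where "e = a *\<^sub>R (g' - gest st)"
  have c: "0 < c" "c \<le> c'" using st nextgam_ge[OF st a] by (auto simp: valid_def c_def c'_def)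
  have x: "x \<in> X" and z: "z \<in> X" using extrapoint_in nextz_in assms by (auto simp: x_def z_def)
  have "(norm e)\<^sup>2 = \<eta>\<^sup>2 * (c'\<^sup>2 - c\<^sup>2)"
    using nextgam_sq[OF st a, of g'] by (simp add: e_def c_def c'_def power_mult_distrib)
  also have "c'\<^sup>2 - c\<^sup>2 = (c' - c) * (c' + c)"
    by (simp add: power2_eq_square algebra_simps)
  finally have e: "(norm e)\<^sup>2 = \<eta>\<^sup>2 * ((c' - c) * (c' + c))" .
  \<comment> \<open>Young's inequality with weight \<open>c'\<close>, kept multiplied by 2 c' until
    the common factor can be cancelled.\<close>
  have "0 \<le> (norm (e - c' *\<^sub>R (x - z)))\<^sup>2" by simp
  also have "\<dots> = (norm e)\<^sup>2 - 2 * c' * inner e (x - z) + c'\<^sup>2 * (norm (x - z))\<^sup>2"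
    by (rule norm_diff_scaleR_squared)
  finally have "2 * c' * inner e (x - z) \<le> \<eta>\<^sup>2 * ((c' - c) * (c' + c)) + c'\<^sup>2 * (norm (x - z))\<^sup>2"
    unfolding e by linarith
  also have "\<dots> \<le> \<eta>\<^sup>2 * ((c' - c) * (2 * c')) + c'\<^sup>2 * (norm (x - z))\<^sup>2"
    using c by (intro add_right_mono mult_left_mono) auto
  also have "\<dots> = 2 * c' * (\<eta>\<^sup>2 * (c' - c) + c' / 2 * (norm (x - z))\<^sup>2)"
    by (simp add: field_simps power2_eq_square)
  finally have young: "inner e (x - z) \<le> \<eta>\<^sup>2 * (c' - c) + c' / 2 * (norm (x - z))\<^sup>2"
    using c by simp
  have "(norm (y - x))\<^sup>2 \<le> D\<^sup>2" using diam[OF y x] by (intro power_mono) auto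
  then have D: "(c' - c) / 2 * (norm (y - x))\<^sup>2 \<le> (c' - c) / 2 * D\<^sup>2"
    using c by (intro mult_left_mono) auto
  have nn: "0 \<le> c / 2 * (norm (x - zpt st))\<^sup>2" using c by simp
  have "a * inner g' z + a * h z + c / 2 * (norm (z - zpt st))\<^sup>2 + (c' - c) / 2 * (norm (x - z))\<^sup>2
      + c' / 2 * (norm (z - y))\<^sup>2
    \<le> a * inner g' y + a * h y + c / 2 * (norm (zpt st - y))\<^sup>2 + (c' - c) / 2 * (norm (y - x))\<^sup>2"
    using nextz_le[OF st a g' y]
    by (simp add: x_def z_def c_def c'_def norm_minus_commute)
  moreover have "a * inner (gest st) x + a * h x + c / 2 * (norm (x - zpt st))\<^sup>2
      + c / 2 * (norm (x - z))\<^sup>2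
    \<le> a * inner (gest st) z + a * h z + c / 2 * (norm (z - zpt st))\<^sup>2"
    using extrapoint_le[OF st a z] by (simp add: x_def c_def)
  moreover have "a * inner g' (x - y) + a * (h x - h y) =
      inner e (x - z) + (a * inner g' z - a * inner g' y + a * h z - a * h y)
      + (a * inner (gest st) x - a * inner (gest st) z + a * h x - a * h z)"
    by (simp add: e_def inner_diff_left inner_diff_right algebra_simps)
  moreover have "(c' - c) / 2 * (norm (x - z))\<^sup>2 + c / 2 * (norm (x - z))\<^sup>2 = c' / 2 * (norm (x - z))\<^sup>2"
    by (simp add: field_simps)
  moreover have "(c' - c) / 2 * D\<^sup>2 + \<eta>\<^sup>2 * (c' - c) = K * (c' - c)"
    by (simp add: K_def field_simps)
  ultimately have "a * inner g' (x - y) + a * (h x - h y)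
      \<le> c / 2 * (norm (zpt st - y))\<^sup>2 - c' / 2 * (norm (z - y))\<^sup>2 + K * (c' - c)"
    using young D nn by linarith
  then show ?thesis by (simp add: x_def z_def c_def c'_def)
qed

text \<open>The new average v balances \<open>xbar st\<close>, the extragradient point and the
  anchor \<open>u\<close> with weights A, a and a^2, so the linear terms at v cancel exactly.
  Tangent gaps at \<open>xbar st\<close> and \<open>u\<close> survive with a negative sign, the one
  at \<open>y\<close> is dropped, and \<open>h\<close> is treated by convexity.\<close>

lemma avgpoint:
  assumes st: "valid st" and a: "a > 0" and u: "u \<in> X" and A: "wgt st \<ge> 0"
  shows avgpoint_in: "avgpoint a u st \<in> X"
    and avgpoint_descent: "y \<in> X \<Longrightarrow>
      (wgt st + a + a\<^sup>2) * (F (avgpoint a u st) - F y) - wgt st * (F (xbar st) - F y)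
        - a\<^sup>2 * (F u - F y)
      \<le> a * inner (Df (avgpoint a u st)) (extrapoint a st - y) + a * (h (extrapoint a st) - h y)
        - wgt st * B (xbar st) (avgpoint a u st) - a\<^sup>2 * B u (avgpoint a u st)"
proof -
  define A where "A = wgt st"
  define A' where "A' = A + a + a\<^sup>2"
  define v where "v = avgpoint a u st"
  define x where "x = extrapoint a st"
  define b where "b = xbar st"
  have A': "A' > 0" "A \<ge> 0" using a A by (auto simp: A'_def A_def add_nonneg_pos)
  have x: "x \<in> X" and b: "b \<in> X" using extrapoint_in[OF st a] st by (auto simp: x_def b_def valid_def)
  have w: "A / A' + a / A' + a\<^sup>2 / A' = 1" "0 \<le> A / A'" "0 \<le> a / A'" "0 \<le> a\<^sup>2 / A'"
    using A' a by (auto simp: add_divide_distrib[symmetric] A'_def)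
  have v: "v = (A / A') *\<^sub>R b + (a / A') *\<^sub>R x + (a\<^sup>2 / A') *\<^sub>R u"
    by (simp add: v_def avgpoint_def A'_def A_def x_def b_def scaleR_add_right)
  have v_in: "v \<in> X"
    unfolding v by (rule convex_comb3[OF b x u w(2-4,1) X(2)])
  then show "avgpoint a u st \<in> X" by (simp add: v_def)
  assume y: "y \<in> X"
  have "h v \<le> (A / A') * h b + (a / A') * h x + (a\<^sup>2 / A') * h u"
    unfolding v by (rule convex_on_comb3[OF b x u w(2-4,1) h])
  then have hv: "A' * h v \<le> A * h b + a * h x + a\<^sup>2 * h u"
    using A' by (simp add: field_simps)
  have "A *\<^sub>R b + a *\<^sub>R x + a\<^sup>2 *\<^sub>R u = A' *\<^sub>R v"
    using A' by (simp add: v scaleR_add_right)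
  then have "inner (Df v) (A *\<^sub>R b + a *\<^sub>R x + a\<^sup>2 *\<^sub>R u) = inner (Df v) (A' *\<^sub>R v)" by simp
  then have lin: "A * inner (Df v) b + a * inner (Df v) x + a\<^sup>2 * inner (Df v) u = A' * inner (Df v) v"
    by (simp add: inner_add_right)
  have "0 \<le> a * B y v" using a B_nonneg in_Rd v_in y by simp
  then have "A' * (favg v - favg y) - A * (favg b - favg y) - a\<^sup>2 * (favg u - favg y)
      \<le> a * inner (Df v) (x - y) - A * B b v - a\<^sup>2 * B u v"
    using lin unfolding bregman_def A'_def by (simp add: inner_diff_right algebra_simps)
  with hv show "(wgt st + a + a\<^sup>2) * (F (avgpoint a u st) - F y) - wgt st * (F (xbar st) - F y)
        - a\<^sup>2 * (F u - F y)
      \<le> a * inner (Df (avgpoint a u st)) (extrapoint a st - y) + a * (h (extrapoint a st) - h y)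
        - wgt st * B (xbar st) (avgpoint a u st) - a\<^sup>2 * B u (avgpoint a u st)"
    unfolding v_def[symmetric] x_def[symmetric] b_def[symmetric] A_def[symmetric]
    unfolding A'_def by (simp add: algebra_simps)
qed

text \<open>\<open>R\<close> counts the iterations left in the epoch. Each of them consumes one a^2
  (F u - F xstar), because the anchor has weight a^2 in the average. The last summand stores the
  error of the current estimate for the next step.\<close>

definition potential :: "real \<Rightarrow> finseq \<Rightarrow> real \<Rightarrow> vstate \<Rightarrow> real" where
  "potential a u R st = wgt st * (F (xbar st) - F xstar) + R * a\<^sup>2 * (F u - F xstar)
    + gam st / 2 * (norm (zpt st - xstar))\<^sup>2 - K * gam st + \<eta>\<^sup>2 * (gam st)\<^sup>2 / (24 * \<beta>)
    + a\<^sup>2 / (8 * \<beta>) * (norm (gest st - Df (xbar st)))\<^sup>2"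

text \<open>The factor 3 from the three-way splitting below turns 1/(24 \<beta>) into 1/(8 \<beta>):
  the old error is met by the stored summand, the change of the full gradient by the divergence at
  \<open>xbar st\<close>, and the new error remains.\<close>

lemma potential_nextstate:
  assumes st: "valid st" and a: "a > 0" and u: "u \<in> X" and A: "wgt st \<ge> a\<^sup>2 / 4"
    and g': "fst e \<in> Rd d"
  defines "v \<equiv> avgpoint a u st"
  shows "potential a u (R - 1) (nextstate a u st e)
    \<le> potential a u R st - a * inner (fst e - Df v) (extrapoint a st - xstar)
      + a\<^sup>2 / (4 * \<beta>) * (norm (fst e - Df v))\<^sup>2 - a\<^sup>2 * B u v"
proof -
  define g where "g = fst e"
  define b where "b = xbar st"
  have A0: "wgt st \<ge> 0" using A by (meson order_trans zero_le_divide_iff zero_le_numeral zero_le_power2)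
  have v: "v \<in> X" unfolding v_def using avgpoint_in[OF st a u A0] .
  have b: "b \<in> X" using st by (simp add: b_def valid_def)
  have Bb: "0 \<le> B b v" using b v in_Rd B_nonneg by auto
  have "(norm (g - gest st))\<^sup>2 = (norm ((g - Df v) + (Df v - Df b) + (Df b - gest st)))\<^sup>2"
    by simp
  also have "\<dots> \<le> 3 * ((norm (g - Df v))\<^sup>2 + (norm (Df v - Df b))\<^sup>2 + (norm (Df b - gest st))\<^sup>2)"
    by (rule norm_sum3_squared_le)
  also have "\<dots> \<le> 3 * ((norm (g - Df v))\<^sup>2 + 2 * \<beta> * B b v + (norm (gest st - Df b))\<^sup>2)"
    using Df_diff_le[of v b] b v in_Rd by (simp add: norm_minus_commute)
  finally have "a\<^sup>2 / (24 * \<beta>) * (norm (g - gest st))\<^sup>2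
      \<le> a\<^sup>2 / (24 * \<beta>) * (3 * ((norm (g - Df v))\<^sup>2 + 2 * \<beta> * B b v + (norm (gest st - Df b))\<^sup>2))"
    using \<beta> by (intro mult_left_mono) auto
  also have "\<dots> = a\<^sup>2 / (8 * \<beta>) * (norm (g - Df v))\<^sup>2 + a\<^sup>2 / 4 * B b v
      + a\<^sup>2 / (8 * \<beta>) * (norm (gest st - Df b))\<^sup>2"
    using \<beta> by (simp add: field_simps)
  \<comment> \<open>The lower bound on the weight is exactly what the change of the full gradient
    costs.\<close>
  also have "a\<^sup>2 / 4 * B b v \<le> wgt st * B b v"
    using A Bb by (intro mult_right_mono) auto
  finally have G: "a\<^sup>2 / (24 * \<beta>) * (norm (g - gest st))\<^sup>2
      \<le> a\<^sup>2 / (8 * \<beta>) * (norm (g - Df v))\<^sup>2 + wgt st * B b v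
        + a\<^sup>2 / (8 * \<beta>) * (norm (gest st - Df b))\<^sup>2"
    by simp
  have sq: "\<eta>\<^sup>2 * (nextgam a st g)\<^sup>2 / (24 * \<beta>) - \<eta>\<^sup>2 * (gam st)\<^sup>2 / (24 * \<beta>)
      = a\<^sup>2 / (24 * \<beta>) * (norm (g - gest st))\<^sup>2"
    using nextgam_sq[OF st a, of g] by (simp add: diff_divide_distrib[symmetric] algebra_simps)
  \<comment> \<open>The new error is charged twice: once for the growth of the squared
    \<open>gam\<close>, once to be stored for the next iteration.\<close>
  have quarter: "a\<^sup>2 / (4 * \<beta>) * N = a\<^sup>2 / (8 * \<beta>) * N + a\<^sup>2 / (8 * \<beta>) * N" for N
    by (simp add: field_simps)
  have ip: "a * inner (g - Df v) (extrapoint a st - xstar)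
      = a * inner g (extrapoint a st - xstar) - a * inner (Df v) (extrapoint a st - xstar)"
    by (simp add: inner_diff_left right_diff_distrib)
  have K: "K * (nextgam a st g - gam st) = K * nextgam a st g - K * gam st"
    by (rule right_diff_distrib)
  have R: "(R - 1) * a\<^sup>2 * (F u - F xstar) = R * a\<^sup>2 * (F u - F xstar) - a\<^sup>2 * (F u - F xstar)"
    by (simp add: left_diff_distrib)
  show ?thesis
    using avgpoint_descent[OF st a u A0 xstar] regret[OF st a g' xstar] G sq
    unfolding potential_def nextstate_def vstate.simps g_def[symmetric] v_def[symmetric]
      b_def[symmetric] quarter ip R K
    by linarith
qed


section \<open>Epochs\<close>

lemma valid_nextstate:
  assumes "valid st" "a > 0" "u \<in> X" "wgt st \<ge> 0" "fst e \<in> Rd d"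
  shows "valid (nextstate a u st e)" "gam st \<le> gam (nextstate a u st e)"
  using assms avgpoint_in[of st a u] nextz_in[of st a "fst e"] nextgam_ge[of st a "fst e"]
  by (auto simp: valid_def nextstate_def)

lemma iteration_support:
  assumes "valid st" "a > 0" "u \<in> X" "wgt st \<ge> 0"
  defines "v \<equiv> avgpoint a u st"
  shows "finite (set_pmf (iteration d n X f h \<eta> a T u t st))"
    and "st' \<in> set_pmf (iteration d n X f h \<eta> a T u t st) \<Longrightarrow>
      \<exists>e. st' = nextstate a u st e \<and> fst e \<in> Rd d \<and> (if t = T then e = (Df v, n) else snd e = 2)"
proof -
  have v: "v \<in> Rd d" and u: "u \<in> Rd d" using avgpoint_in[of st a u] assms in_Rd by auto
  show "finite (set_pmf (iteration d n X f h \<eta> a T u t st))"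
    using n by (simp add: iteration_eq estimate_def)
  assume st': "st' \<in> set_pmf (iteration d n X f h \<eta> a T u t st)"
  show "\<exists>e. st' = nextstate a u st e \<and> fst e \<in> Rd d \<and> (if t = T then e = (Df v, n) else snd e = 2)"
  proof (cases "t = T")
    case True
    then show ?thesis
      using st' Df_in_Rd[OF v] by (auto simp: iteration_eq estimate_def v_def)
  next
    case False
    then obtain i where i: "i \<in> {1..n}"
      "st' = nextstate a u st (grad d (f i) v - grad d (f i) u + Df u, 2)"
      using st' n by (auto simp: iteration_eq estimate_def v_def)
    then have "grad d (f i) v - grad d (f i) u + Df u \<in> Rd d"
      using f_diff u v by (auto intro!: grad_in_Rd Rd_closed(2,3) Df_in_Rd)
    then show ?thesis using i False by auto
  qed
qed

text \<open>On average the inner product vanishes, since \<open>dx\<close> does not depend on the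
  draw, and the squared error is at most 2 \<beta> B(u, v). It costs a^2/2 times B(u, v), half of
  what the anchor provides. In the last iteration the gradient is exact and there is no
  error.\<close>

lemma potential_iteration:
  assumes st: "valid st" and a: "a > 0" and u: "u \<in> X" and A: "wgt st \<ge> a\<^sup>2 / 4"
  shows "measure_pmf.expectation (iteration d n X f h \<eta> a T u t st) (potential a u (R - 1))
    \<le> potential a u R st"
proof -
  define v where "v = avgpoint a u st"
  define P where "P = potential a u R st"
  define dx where "dx = extrapoint a st - xstar"
  have A0: "wgt st \<ge> 0" using A by (meson order_trans zero_le_divide_iff zero_le_numeral zero_le_power2)
  have v: "v \<in> Rd d" and u': "u \<in> Rd d" using avgpoint_in[OF st a u A0] u in_Rd by (auto simp: v_def)
  have B: "0 \<le> B u v" using B_nonneg[OF v u'] .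
  have le: "potential a u (R - 1) (nextstate a u st e)
    \<le> P - a * inner (fst e - Df v) dx + a\<^sup>2 / (4 * \<beta>) * (norm (fst e - Df v))\<^sup>2 - a\<^sup>2 * B u v"
    if "fst e \<in> Rd d" for e
    using potential_nextstate[OF st a u A that] by (simp add: v_def P_def dx_def)
  show ?thesis
  proof (cases "t = T")
    case True
    have "potential a u (R - 1) (nextstate a u st (Df v, n)) \<le> P - a\<^sup>2 * B u v"
      using le[of "(Df v, n)"] Df_in_Rd[OF v] by simp
    also have "\<dots> \<le> P" using B by simp
    finally show ?thesis using True by (simp add: iteration_eq estimate_def v_def P_def)
  next
    case False
    define w where "w i = grad d (f i) v - grad d (f i) u + Df u" for i
    define N where "N = (\<Sum>i = 1..n. (norm (w i - Df v))\<^sup>2)"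
    have w: "w i \<in> Rd d" if "i \<in> {1..n}" for i
      unfolding w_def using f_diff that u' v by (auto intro!: grad_in_Rd Rd_closed(2,3) Df_in_Rd)
    have "(\<Sum>i = 1..n. potential a u (R - 1) (nextstate a u st (w i, 2)))
        \<le> (\<Sum>i = 1..n. P - a * inner (w i - Df v) dx
            + a\<^sup>2 / (4 * \<beta>) * (norm (w i - Df v))\<^sup>2 - a\<^sup>2 * B u v)"
      using le[of "(w i, 2)" for i] w by (intro sum_mono) auto
    also have "\<dots> = real n * P - a * inner (\<Sum>i = 1..n. w i - Df v) dx
        + a\<^sup>2 / (4 * \<beta>) * N - real n * (a\<^sup>2 * B u v)"
      by (simp add: sum.distrib sum_subtractf N_def sum_distrib_left inner_sum_left inner_diff_left
          right_diff_distrib)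
    also have "(\<Sum>i = 1..n. w i - Df v) = 0"
      unfolding w_def by (rule estimate_unbiased[OF u' v])
    also have "N \<le> real n * (2 * \<beta> * B u v)"
      using estimate_variance[OF u' v] n by (simp add: N_def w_def field_simps)
    then have "a\<^sup>2 / (4 * \<beta>) * N \<le> a\<^sup>2 / (4 * \<beta>) * (real n * (2 * \<beta> * B u v))"
      using \<beta> by (intro mult_left_mono) auto
    also have "a\<^sup>2 / (4 * \<beta>) * (real n * (2 * \<beta> * B u v)) = real n * (a\<^sup>2 * B u v) / 2"
      using \<beta> by (simp add: field_simps)
    also have "\<dots> \<le> real n * (a\<^sup>2 * B u v)" using B by simp
    finally have "(\<Sum>i = 1..n. potential a u (R - 1) (nextstate a u st (w i, 2))) \<le> real n * P"
      by simp
    then have "(\<Sum>i = 1..n. potential a u (R - 1) (nextstate a u st (w i, 2))) / real n \<le> P"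
      using n by (simp add: field_simps)
    moreover have "iteration d n X f h \<eta> a T u t st
        = map_pmf (\<lambda>i. nextstate a u st (w i, 2)) (pmf_of_set {1..n})"
      using False by (simp add: iteration_eq estimate_def v_def w_def pmf.map_comp o_def)
    ultimately show ?thesis using n by (simp add: integral_pmf_of_set P_def)
  qed
qed

text \<open>Weights increase inside an epoch, so the bound a^2/4 is asked only at its start. The
  count charges 2 evaluations to the last iteration too, in addition to its n.\<close>

lemma iterations_invariant:
  assumes st: "valid st" and a: "a > 0" and u: "u \<in> X" and A: "wgt st \<ge> a\<^sup>2 / 4" and "t \<le> T"
  defines "M \<equiv> \<lambda>t. iterations d n X f h \<eta> a T u t st"
  shows "finite (set_pmf (M t))"
    and "\<forall>st'\<in>set_pmf (M t). valid st' \<and> wgt st' = wgt st + real t * (a + a\<^sup>2) \<and> gam st \<le> gam st'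
      \<and> evals st' \<le> evals st + 2 * t + (if t = T then n else 0)
      \<and> (0 < t \<and> t = T \<longrightarrow> gest st' = Df (xbar st'))"
    and "measure_pmf.expectation (M t) (potential a u (real T - real t)) \<le> potential a u T st"
proof -
  have "finite (set_pmf (M t))
    \<and> (\<forall>st'\<in>set_pmf (M t). valid st' \<and> wgt st' = wgt st + real t * (a + a\<^sup>2) \<and> gam st \<le> gam st'
      \<and> evals st' \<le> evals st + 2 * t + (if t = T then n else 0)
      \<and> (0 < t \<and> t = T \<longrightarrow> gest st' = Df (xbar st')))
    \<and> measure_pmf.expectation (M t) (potential a u (real T - real t)) \<le> potential a u T st"
    using \<open>t \<le> T\<close>
  proof (induction t)
    case 0
    then show ?case using st by (simp add: M_def)
  next
    case (Suc t)
    let ?q = "iteration d n X f h \<eta> a T u (Suc t)"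
    have M: "M (Suc t) = M t \<bind> ?q" by (simp add: M_def)
    have fin: "finite (set_pmf (M t))" and
      IH: "\<And>st'. st' \<in> set_pmf (M t) \<Longrightarrow> valid st' \<and> wgt st' = wgt st + real t * (a + a\<^sup>2)
        \<and> gam st \<le> gam st' \<and> evals st' \<le> evals st + 2 * t"
      and E: "measure_pmf.expectation (M t) (potential a u (real T - real t)) \<le> potential a u T st"
      using Suc by auto
    have wgt: "a\<^sup>2 / 4 \<le> wgt st'" "0 \<le> wgt st'" if "st' \<in> set_pmf (M t)" for st'
    proof -
      have "0 \<le> real t * (a + a\<^sup>2)" using a by simp
      then show "a\<^sup>2 / 4 \<le> wgt st'" using IH[OF that] A by linarith
      then show "0 \<le> wgt st'" by (meson order_trans zero_le_divide_iff zero_le_numeral zero_le_power2)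
    qed
    have finq: "finite (set_pmf (?q st'))" if "st' \<in> set_pmf (M t)" for st'
      using iteration_support(1) IH wgt a u that by blast
    have "finite (set_pmf (M (Suc t)))"
      using fin finq by (simp add: M)
    moreover have "valid st'' \<and> wgt st'' = wgt st + real (Suc t) * (a + a\<^sup>2) \<and> gam st \<le> gam st''
      \<and> evals st'' \<le> evals st + 2 * Suc t + (if Suc t = T then n else 0)
      \<and> (0 < Suc t \<and> Suc t = T \<longrightarrow> gest st'' = Df (xbar st''))" if st'': "st'' \<in> set_pmf (M (Suc t))" for st''
    proof -
      obtain st' where st': "st' \<in> set_pmf (M t)" "st'' \<in> set_pmf (?q st')"
        using st'' by (auto simp: M)
      note I = IH[OF st'(1)]
      obtain e where e: "st'' = nextstate a u st' e" "fst e \<in> Rd d"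
        "if Suc t = T then e = (Df (avgpoint a u st'), n) else snd e = 2"
        using iteration_support(2)[OF _ a u wgt(2)[OF st'(1)] st'(2)] I by blast
      have "valid st''" "gam st' \<le> gam st''"
        using valid_nextstate[OF _ a u wgt(2)[OF st'(1)] e(2)] I e(1) by auto
      then show ?thesis
        using I e by (auto simp: nextstate_def algebra_simps split: if_splits)
    qed
    moreover have "measure_pmf.expectation (M (Suc t)) (potential a u (real T - real (Suc t)))
        \<le> measure_pmf.expectation (M t) (potential a u (real T - real t))"
      unfolding M
    proof (rule expectation_bind_le[OF fin finq])
      fix st' assume st': "st' \<in> set_pmf (M t)"
      have "real T - real (Suc t) = real T - real t - 1" by simp
      then show "measure_pmf.expectation (?q st') (potential a u (real T - real (Suc t)))
          \<le> potential a u (real T - real t) st'"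
        using potential_iteration[OF _ a u wgt(1)[OF st']] IH[OF st'] by metis
    qed
    ultimately show ?case using E by auto
  qed
  then show "finite (set_pmf (M t))"
    and "\<forall>st'\<in>set_pmf (M t). valid st' \<and> wgt st' = wgt st + real t * (a + a\<^sup>2) \<and> gam st \<le> gam st'
      \<and> evals st' \<le> evals st + 2 * t + (if t = T then n else 0)
      \<and> (0 < t \<and> t = T \<longrightarrow> gest st' = Df (xbar st'))"
    and "measure_pmf.expectation (M t) (potential a u (real T - real t)) \<le> potential a u T st"
    by auto
qed

text \<open>The potential between epochs. It no longer mentions the step size, so it can be chained
  across epochs with different steps.\<close>

definition energy :: "vstate \<Rightarrow> real" where
  "energy st = wgt st * (F (xbar st) - F xstar) + gam st / 2 * (norm (zpt st - xstar))\<^sup>2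
    - K * gam st + \<eta>\<^sup>2 * (gam st)\<^sup>2 / (24 * \<beta>)"

text \<open>At the start, the prepaid n a^2 (F u - F xstar) makes up for the weight deducted and the
  stored error is zero; at the end nothing is prepaid and the remaining error term is
  nonnegative.\<close>

lemma epoch_invariant:
  assumes st: "valid st" and g: "gest st = Df (xbar st)" and a: "a > 0"
    and A: "wgt st - real n * a\<^sup>2 \<ge> a\<^sup>2 / 4"
  defines "M \<equiv> epoch d n X f h \<eta> a n st"
  shows "finite (set_pmf M)"
    and "st' \<in> set_pmf M \<Longrightarrow> valid st' \<and> wgt st' = wgt st + real n * a \<and> gam st \<le> gam st'
      \<and> evals st' \<le> evals st + 3 * n \<and> gest st' = Df (xbar st')"
    and "measure_pmf.expectation M energy \<le> energy st"
proof -
  let ?st = "st\<lparr>wgt := wgt st - real n * a\<^sup>2\<rparr>"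
  have "valid ?st" and u: "xbar st \<in> X" using st by (simp_all add: valid_def)
  note I = iterations_invariant[OF \<open>valid ?st\<close> a u, of n n]
  have M: "M = iterations d n X f h \<eta> a n (xbar st) n ?st" by (simp add: M_def epoch_def)
  show fin: "finite (set_pmf M)" using I(1) A by (simp add: M)
  have S: "valid st' \<and> wgt st' = wgt st + real n * a \<and> gam st \<le> gam st'
      \<and> evals st' \<le> evals st + 3 * n \<and> gest st' = Df (xbar st')" if "st' \<in> set_pmf M" for st'
    using bspec[OF I(2) that[unfolded M]] A n by (simp add: algebra_simps)
  then show "st' \<in> set_pmf M \<Longrightarrow> valid st' \<and> wgt st' = wgt st + real n * a \<and> gam st \<le> gam st'
      \<and> evals st' \<le> evals st + 3 * n \<and> gest st' = Df (xbar st')" .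
  have "measure_pmf.expectation M energy \<le> measure_pmf.expectation M (potential a (xbar st) 0)"
    using S by (intro expectation_mono fin) (simp add: energy_def potential_def)
  also have "\<dots> \<le> potential a (xbar st) (real n) ?st"
    using I(3) A by (simp add: M)
  also have "\<dots> = energy st"
    using g by (simp add: potential_def energy_def algebra_simps)
  finally show "measure_pmf.expectation M energy \<le> energy st" .
qed

text \<open>\<open>W s\<close> is the deterministic weight after epoch s: n iterations add a + a^2
  each, and the deduction removes n a^2. The first n evaluations belong to the initial
  gradient.\<close>

lemma AdaVRAE_invariant:
  fixes a W :: "nat \<Rightarrow> real" and u0 :: finseq
  assumes u0: "u0 \<in> X" and \<gamma>: "\<gamma> > 0" and a: "\<And>s. a (Suc s) > 0"
    and W: "\<And>s. W (Suc s) = W s + real n * a (Suc s)"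
    and W_ge: "\<And>s. W s - real n * (a (Suc s))\<^sup>2 \<ge> (a (Suc s))\<^sup>2 / 4"
  defines "M \<equiv> AdaVRAE d n X f h a (\<lambda>_. n) (W 0) \<eta> \<gamma> u0"
    and "st0 \<equiv> \<lparr>xbar = u0, zpt = u0, gest = Df u0, gam = \<gamma>, wgt = W 0, evals = n\<rparr>"
  shows "finite (set_pmf (M s))
    \<and> (\<forall>st\<in>set_pmf (M s). valid st \<and> wgt st = W s \<and> \<gamma> \<le> gam st \<and> evals st \<le> n + 3 * n * s
      \<and> gest st = Df (xbar st))
    \<and> measure_pmf.expectation (M s) energy \<le> energy st0"
proof (induction s)
  case 0
  show ?case using u0 \<gamma> Df_in_Rd in_Rd by (simp add: M_def st0_def valid_def)
next
  case (Suc s)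
  let ?q = "epoch d n X f h \<eta> (a (Suc s)) n"
  have M: "M (Suc s) = M s \<bind> ?q" by (simp add: M_def)
  have I: "finite (set_pmf (?q st))"
      "st' \<in> set_pmf (?q st) \<Longrightarrow> valid st' \<and> wgt st' = W s + real n * a (Suc s) \<and> gam st \<le> gam st'
      \<and> evals st' \<le> evals st + 3 * n \<and> gest st' = Df (xbar st')"
      "measure_pmf.expectation (?q st) energy \<le> energy st"
    if "st \<in> set_pmf (M s)" for st st'
  proof -
    have st: "valid st" "wgt st = W s" "gest st = Df (xbar st)" using Suc that by blast+
    have "wgt st - real n * (a (Suc s))\<^sup>2 \<ge> (a (Suc s))\<^sup>2 / 4"
      unfolding st(2) by (rule W_ge)
    note E = epoch_invariant[OF st(1,3) a this]
    show "finite (set_pmf (?q st))" "measure_pmf.expectation (?q st) energy \<le> energy st"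
      by (rule E)+
    show "valid st' \<and> wgt st' = W s + real n * a (Suc s) \<and> gam st \<le> gam st'
      \<and> evals st' \<le> evals st + 3 * n \<and> gest st' = Df (xbar st')" if "st' \<in> set_pmf (?q st)"
      using E(2)[OF that] st(2) by simp
  qed
  have "finite (set_pmf (M (Suc s)))" using Suc I(1) by (simp add: M)
  moreover have "valid st \<and> wgt st = W (Suc s) \<and> \<gamma> \<le> gam st \<and> evals st \<le> n + 3 * n * Suc s
      \<and> gest st = Df (xbar st)" if st: "st \<in> set_pmf (M (Suc s))" for st
  proof -
    obtain st' where st': "st' \<in> set_pmf (M s)" "st \<in> set_pmf (?q st')" using st by (auto simp: M)
    have "\<gamma> \<le> gam st'" "evals st' \<le> n + 3 * n * s" using Suc st' by auto
    with I(2)[OF st'] show ?thesis by (simp add: W)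
  qed
  moreover have "measure_pmf.expectation (M (Suc s)) energy \<le> measure_pmf.expectation (M s) energy"
    unfolding M using Suc I by (intro expectation_bind_le) auto
  ultimately show ?case using Suc by auto
qed

lemma AdaVRAE_bound:
  fixes a W :: "nat \<Rightarrow> real" and u0 :: finseq
  assumes u0: "u0 \<in> X" and \<gamma>: "\<gamma> > 0" and a: "\<And>s. a (Suc s) > 0"
    and W: "\<And>s. W (Suc s) = W s + real n * a (Suc s)"
    and W_ge: "\<And>s. W s - real n * (a (Suc s))\<^sup>2 \<ge> (a (Suc s))\<^sup>2 / 4"
  defines "M \<equiv> AdaVRAE d n X f h a (\<lambda>_. n) (W 0) \<eta> \<gamma> u0"
  shows "W s * measure_pmf.expectation (M s) (\<lambda>st. F (xbar st) - F xstar)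
      \<le> W 0 * (F u0 - F xstar) + \<gamma> / 2 * (norm (u0 - xstar))\<^sup>2 + 6 * \<beta> * K\<^sup>2 / \<eta>\<^sup>2"
    and "st \<in> set_pmf (M s) \<Longrightarrow> evals st \<le> n + 3 * n * s"
proof -
  let ?st0 = "\<lparr>xbar = u0, zpt = u0, gest = Df u0, gam = \<gamma>, wgt = W 0, evals = n\<rparr>"
  \<comment> \<open>A lower bound for the part of the energy depending on \<open>gam\<close> alone.
    Its first two summands cancel the same terms of the initial energy, so neither survives in the
    result.\<close>
  define C where "C = - K * \<gamma> + \<eta>\<^sup>2 * \<gamma>\<^sup>2 / (24 * \<beta>) - 6 * \<beta> * K\<^sup>2 / \<eta>\<^sup>2"
  note I = AdaVRAE_invariant[where W = W, OF u0 \<gamma> a W W_ge, of s, folded M_def]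
  then show "st \<in> set_pmf (M s) \<Longrightarrow> evals st \<le> n + 3 * n * s" by blast
  have fin: "finite (set_pmf (M s))" using I by blast
  have "W s * (F (xbar st) - F xstar) + C \<le> energy st" if "st \<in> set_pmf (M s)" for st
  proof -
    define y where "y = gam st - \<gamma>"
    have y: "y \<ge> 0" and st: "wgt st = W s" "gam st > 0" using I that by (auto simp: y_def valid_def)
    \<comment> \<open>The square vanishes at y = 12 \<beta> K / \<eta>^2, the minimiser of the
      quadratic in the growth y of \<open>gam\<close>.\<close>
    have "0 \<le> (\<eta> * y - 12 * \<beta> * K / \<eta>)\<^sup>2 / (24 * \<beta>)" using \<beta> by simp
    also have "\<dots> = \<eta>\<^sup>2 * y\<^sup>2 / (24 * \<beta>) - K * y + 6 * \<beta> * K\<^sup>2 / \<eta>\<^sup>2"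
      using \<beta> \<eta> by (simp add: power2_eq_square field_simps)
    also have "\<eta>\<^sup>2 * y\<^sup>2 / (24 * \<beta>) \<le> \<eta>\<^sup>2 * ((gam st)\<^sup>2 - \<gamma>\<^sup>2) / (24 * \<beta>)"
    proof -
      have "(gam st)\<^sup>2 - \<gamma>\<^sup>2 = y\<^sup>2 + 2 * \<gamma> * y" by (simp add: y_def power2_eq_square algebra_simps)
      also have "\<dots> \<ge> y\<^sup>2" using y \<gamma> by simp
      finally show ?thesis using \<beta> by (intro divide_right_mono mult_left_mono) auto
    qed
    finally have "C \<le> \<eta>\<^sup>2 * (gam st)\<^sup>2 / (24 * \<beta>) - K * gam st"
      by (simp add: C_def y_def right_diff_distrib diff_divide_distrib)
    moreover have "0 \<le> gam st / 2 * (norm (zpt st - xstar))\<^sup>2" using st by simp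
    ultimately show ?thesis by (simp add: energy_def st)
  qed
  then have "measure_pmf.expectation (M s) (\<lambda>st. W s * (F (xbar st) - F xstar) + C)
      \<le> measure_pmf.expectation (M s) energy"
    by (intro expectation_mono fin)
  also have "\<dots> \<le> energy ?st0" using I by blast
  also have "measure_pmf.expectation (M s) (\<lambda>st. W s * (F (xbar st) - F xstar) + C)
      = W s * measure_pmf.expectation (M s) (\<lambda>st. F (xbar st) - F xstar) + C"
    using fin by (subst Bochner_Integration.integral_add) (auto intro!: integrable_measure_pmf_finite)
  finally show "W s * measure_pmf.expectation (M s) (\<lambda>st. F (xbar st) - F xstar)
      \<le> W 0 * (F u0 - F xstar) + \<gamma> / 2 * (norm (u0 - xstar))\<^sup>2 + 6 * \<beta> * K\<^sup>2 / \<eta>\<^sup>2"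
    by (simp add: energy_def C_def)
qed

end

section \<open>Step sizes\<close>

text \<open>As 4n \<ge> 4, the iterated logarithm is at least 1, so \<open>nat\<close> truncates
  nothing.\<close>

lemma s_zero_bounds:
  assumes "n \<ge> 1"
  shows "1 \<le> s_zero n" "log 2 (4 * real n) \<le> 2 ^ s_zero n"
    and "real (s_zero n) \<le> log 2 (log 2 (4 * real n)) + 1"
proof -
  define L where "L = log 2 (4 * real n)"
  have "log 2 (2 ^ 2) \<le> L" unfolding L_def using assms by (subst log_le_cancel_iff) auto
  then have L: "2 \<le> L" by (subst (asm) log_nat_power) auto
  then have "log 2 2 \<le> log 2 L" by (subst log_le_cancel_iff) auto
  then have l: "1 \<le> log 2 L" by simp
  then show "1 \<le> s_zero n" "real (s_zero n) \<le> log 2 (log 2 (4 * real n)) + 1"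
    unfolding s_zero_def L_def[symmetric] by linarith+
  have "L = 2 powr log 2 L" using L by simp
  also have "\<dots> \<le> 2 powr real (s_zero n)"
    using l unfolding s_zero_def L_def[symmetric] by (intro powr_mono) linarith+
  finally show "L \<le> 2 ^ s_zero n" by (simp add: powr_realpow)
qed

lemma step_size_early: "s \<le> s_zero n \<Longrightarrow> step_size n s = (4 * real n) powr (- ((1 / 2) ^ s))"
  by (simp add: step_size_def)

lemma step_size_late: "step_size n (Suc (s_zero n + m)) = (real m + 3 / 2) / 3"
  by (simp add: step_size_def)

lemma step_size_pos:
  assumes "n \<ge> 1"
  shows "step_size n s > 0"
  using assms by (auto simp: step_size_def Let_def)

text \<open>Halving the exponent: the deduction n a^2 of an early epoch is then n times the previous
  step, which is the weight gained in the previous epoch.\<close>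

lemma step_size_square:
  assumes "Suc s \<le> s_zero n"
  shows "(step_size n (Suc s))\<^sup>2 = step_size n s"
  using assms by (simp add: step_size_early power2_eq_square powr_add[symmetric])

lemma step_size_s_zero:
  assumes "n \<ge> 1"
  shows "1 / 2 \<le> step_size n (s_zero n)"
proof -
  define L where "L = log 2 (4 * real n)"
  have "L * (1 / 2) ^ s_zero n \<le> 1"
    using s_zero_bounds(2)[OF assms] by (simp add: L_def power_divide)
  then have "2 powr (- 1) \<le> 2 powr (L * - ((1 / 2) ^ s_zero n))"
    by (intro powr_mono) auto
  also have "\<dots> = (2 powr L) powr - ((1 / 2) ^ s_zero n)" by (rule powr_powr[symmetric])
  also have "2 powr L = 4 * real n" using assms by (simp add: L_def)
  finally show ?thesis by (simp add: step_size_early powr_minus_divide)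
qed

definition weight :: "nat \<Rightarrow> nat \<Rightarrow> real" where
  "weight n s = 5 / 4 + real n * (\<Sum>k = 1..s. step_size n k)"

lemma weight_Suc: "weight n (Suc s) = weight n s + real n * step_size n (Suc s)"
  by (simp add: weight_def algebra_simps)

lemma weight_ge_step:
  assumes "n \<ge> 1" "s \<ge> 1"
  shows "5 / 4 + real n * step_size n s \<le> weight n s"
proof -
  have "step_size n s \<le> (\<Sum>k = 1..s. step_size n k)"
    using assms by (intro member_le_sum) (auto intro: less_imp_le[OF step_size_pos])
  then show ?thesis unfolding weight_def by (simp add: mult_left_mono)
qed

text \<open>The first step is (4n)^(-1/2), so a single epoch already reaches the order of the square
  root of n.\<close>

lemma weight_one: "n \<ge> 1 \<Longrightarrow> sqrt (real n) / 2 \<le> weight n 1"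
proof -
  assume n: "n \<ge> 1"
  have "step_size n 1 = (4 * real n) powr (- (1 / 2))"
    using s_zero_bounds[OF n] by (simp add: step_size_early)
  also have "\<dots> = 1 / (2 * sqrt (real n))"
    using n by (simp add: powr_minus_divide powr_half_sqrt real_sqrt_mult)
  finally have "real n * step_size n 1 = sqrt (real n) / 2"
    using n by (simp add: real_div_sqrt)
  then show ?thesis using weight_ge_step[OF n, of 1] by simp
qed

text \<open>The late step (2m + 3)/6 is the increment of m (m + 2)/6 from m to m + 1, and the last
  early step, at least 1/2, gives the base.\<close>

lemma weight_late:
  assumes "n \<ge> 1"
  shows "5 / 4 + real n * (1 / 2 + real m * (real m + 2) / 6) \<le> weight n (s_zero n + m)"
proof (induction m)
  case 0
  have "real n * (1 / 2) \<le> real n * step_size n (s_zero n)"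
    using step_size_s_zero[OF assms] by (intro mult_left_mono) auto
  then show ?case using weight_ge_step[OF assms s_zero_bounds(1)[OF assms]] by simp
next
  case (Suc m)
  then show ?case by (simp only: weight_Suc step_size_late add_Suc_right) (simp add: field_simps)
qed

lemma weight_late':
  assumes "n \<ge> 1"
  shows "real n * (real m + 1)\<^sup>2 / 6 \<le> weight n (s_zero n + m)"
proof -
  have "(real m + 1)\<^sup>2 / 6 \<le> 1 / 2 + real m * (real m + 2) / 6"
    by (simp add: power2_eq_square field_simps)
  then have "real n * ((real m + 1)\<^sup>2 / 6) \<le> real n * (1 / 2 + real m * (real m + 2) / 6)"
    by (intro mult_left_mono) auto
  with weight_late[OF assms, of m] show ?thesis by simp
qed

lemma weight_dominates:
  assumes n: "n \<ge> 1"
  shows "(step_size n (Suc s))\<^sup>2 / 4 \<le> weight n s - real n * (step_size n (Suc s))\<^sup>2"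
proof (cases "Suc s \<le> s_zero n")
  case True
  have "step_size n s \<le> (4 * real n) powr 0"
    unfolding step_size_early[OF Suc_leD[OF True]] using n by (intro powr_mono) auto
  then have "step_size n s \<le> 1" using n by simp
  moreover have "1 + real n * step_size n s \<le> weight n s"
  proof (cases "s = 0")
    case True
    \<comment> \<open>The formula gives 1/(4n) at index 0, so the initial weight 5/4 splits as 1
      plus n times this value.\<close>
    then show ?thesis using n by (simp add: step_size_early weight_def powr_minus_divide)
  next
    case False
    then show ?thesis using weight_ge_step[OF n, of s] by simp
  qed
  ultimately show ?thesis by (simp add: step_size_square[OF True])
next
  case False
  define m where "m = real (s - s_zero n)"
  have s: "s = s_zero n + (s - s_zero n)" using False by simp
  have a: "step_size n (Suc s) = (m + 3 / 2) / 3"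
    using step_size_late[of n "s - s_zero n"] s m_def by simp
  have m: "0 \<le> m" by (simp add: m_def)
  \<comment> \<open>In fact an equality: m^2/18 + 1/4 is the surplus per unit of n after the
    deduction. One such unit and the initial 5/4 cover the required a^2/4.\<close>
  have "(m + 3 / 2)\<^sup>2 / 9 \<le> 1 / 2 + m * (m + 2) / 6 - (m\<^sup>2 / 18 + 1 / 4)"
    by (simp add: power2_eq_square field_simps)
  then have "real n * ((m + 3 / 2)\<^sup>2 / 9) \<le> real n * (1 / 2 + m * (m + 2) / 6 - (m\<^sup>2 / 18 + 1 / 4))"
    by (intro mult_left_mono) auto
  moreover have "m\<^sup>2 / 18 + 1 / 4 \<le> real n * (m\<^sup>2 / 18 + 1 / 4)"
    using n mult_right_mono[of 1 "real n" "m\<^sup>2 / 18 + 1 / 4"] by simp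
  moreover have "(m + 3 / 2)\<^sup>2 / 36 \<le> 5 / 4 + (m\<^sup>2 / 18 + 1 / 4)"
  proof -
    have "0 \<le> (m - 3 / 2)\<^sup>2 / 36" by simp
    then show ?thesis by (simp add: power2_eq_square field_simps)
  qed
  moreover have "5 / 4 + real n * (1 / 2 + m * (m + 2) / 6) \<le> weight n s"
    using weight_late[OF n, of "s - s_zero n"] s by (simp add: m_def)
  moreover have sq: "(step_size n (Suc s))\<^sup>2 = (m + 3 / 2)\<^sup>2 / 9"
    by (simp add: a power_divide)
  ultimately show ?thesis
    unfolding sq right_diff_distrib[of "real n"] by linarith
qed

section \<open>The iterated logarithm and the number of epochs\<close>

lemma loglog_ge_1: "1 \<le> loglog x"
  by (simp add: loglog_def)

text \<open>Truncating the inner logarithm at e matches the convention that \<open>loglog\<close> is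
  at least 1, and keeps the outer logarithm monotone in later estimates.\<close>

lemma ln_max_le_loglog:
  assumes "1 < x"
  shows "ln (max (exp 1) (ln x)) \<le> loglog x"
proof (cases "exp 1 \<le> ln x")
  case True
  then show ?thesis using assms by (simp add: loglog_def max_def)
next
  case False
  then show ?thesis using loglog_ge_1[of x] by (simp add: max_def)
qed

lemma exp_1_ge_2: "2 \<le> exp (1::real)"
  using exp_ge_add_one_self[of 1] by simp

lemma s_zero_le_loglog:
  assumes n: "n \<ge> 1"
  shows "real (s_zero n) \<le> 5 * loglog (real n)"
proof -
  define M where "M = max (exp 1) (ln (real n))"
  have M: "2 \<le> M" "ln (real n) \<le> M" using exp_1_ge_2 by (auto simp: M_def)
  have ln2: "2 / 3 \<le> ln (2::real)" by (rule ln2_ge_two_thirds)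
  have div_ln2: "z / ln 2 \<le> 3 / 2 * z" if "0 \<le> z" for z :: real
  proof -
    have "z / ln 2 \<le> z / (2 / 3)" using that ln2 by (intro divide_left_mono) auto
    then show ?thesis by simp
  qed
  have "log 2 (4 * real n) = 2 + ln (real n) / ln 2"
  proof -
    have "ln (4::real) = 2 * ln 2" using ln_realpow[of 2 2] by simp
    then show ?thesis using n by (simp add: log_def ln_mult add_divide_distrib)
  qed
  also have "\<dots> \<le> 2 + 3 / 2 * ln (real n)" using div_ln2[of "ln (real n)"] n by simp
  \<comment> \<open>The generous factor 4 contributes exactly 2 to the binary logarithm.\<close>
  also have "\<dots> \<le> 4 * M" using M by simp
  finally have "log 2 (log 2 (4 * real n)) \<le> log 2 (4 * M)"
    using n M by (intro log_mono) (auto simp: log_def)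
  also have "\<dots> = 2 + ln M / ln 2"
  proof -
    have "ln (4::real) = 2 * ln 2" using ln_realpow[of 2 2] by simp
    then show ?thesis using M by (simp add: log_def ln_mult add_divide_distrib)
  qed
  also have "\<dots> \<le> 2 + 3 / 2 * ln M" using div_ln2[of "ln M"] M by simp
  also have "ln M \<le> loglog (real n)"
  proof (cases "n = 1")
    case True
    then show ?thesis by (simp add: M_def loglog_def)
  next
    case False
    then show ?thesis unfolding M_def using n by (intro ln_max_le_loglog) auto
  qed
  finally show ?thesis using s_zero_bounds(3)[OF n] loglog_ge_1[of "real n"] by linarith
qed

text \<open>Squaring and a factor 4 multiply the truncated logarithm by at most 4, hence add at most
  ln 4 \<le> 2 after the second logarithm; since \<open>loglog\<close> is at least 1, this is a
  factor 3.\<close>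

lemma loglog_le_of_square:
  assumes x: "x > 0" and y: "y \<le> 4 * x\<^sup>2"
  shows "loglog y \<le> 3 * loglog x"
proof (cases "y > 1 \<and> ln y > exp 1")
  case False
  then have "ln (ln y) \<le> ln (exp 1)" if "y > 1"
    using that by (subst ln_le_cancel_iff) auto
  then have "loglog y = 1" by (auto simp: loglog_def)
  then show ?thesis using loglog_ge_1[of x] by simp
next
  case True
  define M where "M = max (exp 1) (ln x)"
  have M: "2 \<le> M" "ln x \<le> M" using exp_1_ge_2 by (auto simp: M_def)
  have ln4: "ln (4::real) \<le> 2"
    using ln_realpow[of 2 2] ln_2_less_1 by simp
  have "ln y \<le> ln (4 * x\<^sup>2)" using True y x by (subst ln_le_cancel_iff) auto
  also have "\<dots> = ln 4 + 2 * ln x" using x by (simp add: ln_mult ln_realpow)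
  finally have le: "ln y \<le> ln 4 + 2 * ln x" .
  then have "0 < ln x" using True exp_1_ge_2 ln4 by linarith
  then have x1: "x > 1" using x by simp
  have "ln y \<le> 4 * M" using le ln4 M by linarith
  then have "ln (ln y) \<le> ln (4 * M)" using True M by (subst ln_le_cancel_iff) auto
  also have "\<dots> = ln 4 + ln M" using M by (simp add: ln_mult)
  also have "ln M \<le> loglog x" unfolding M_def using x1 by (rule ln_max_le_loglog)
  finally have "ln (ln y) \<le> 2 + loglog x" using ln4 by simp
  then show ?thesis using True loglog_ge_1[of x] by (simp add: loglog_def[of y])
qed

text \<open>One epoch suffices while \<open>V / \<epsilon> \<le> sqrt n / 2\<close>; beyond that, \<open>loglog (V / \<epsilon>)\<close> is of the order of
  \<open>s_zero n\<close>, and \<open>s_zero n + 2\<close> epochs reach weight \<open>n\<close>.\<close>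
lemma enough_epochs:
  assumes n: "n \<ge> 1" and V: "V > 0" and \<epsilon>: "\<epsilon> > 0"
  obtains S where "S \<ge> 1" "V / \<epsilon> \<le> weight n S"
    "real (n + 3 * n * S) \<le> 100 * (if \<epsilon> \<ge> V / real n then real n * loglog (V / \<epsilon>)
                   else real n * loglog (real n) + sqrt (V * real n / \<epsilon>))"
proof -
  define x where "x = V / \<epsilon>"
  have x: "x > 0" using V \<epsilon> by (simp add: x_def)
  have cost: "real (n + 3 * n * S) \<le> 4 * (real n * real S)" if "S \<ge> 1" for S
  proof -
    have "real n * 1 \<le> real n * real S" using that by (intro mult_left_mono) auto
    then show ?thesis by (simp add: mult.commute)
  qed
  show ?thesis
  proof (cases "\<epsilon> \<ge> V / real n")
    case True
    then have xn: "x \<le> real n" using n \<epsilon> by (simp add: x_def field_simps)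
    have ll: "real n * 1 \<le> real n * loglog x" using loglog_ge_1 by (intro mult_left_mono) auto
    show ?thesis
    proof (cases "x \<le> sqrt (real n) / 2")
      case small: True
      have "x \<le> weight n 1" using small weight_one[OF n] by linarith
      then show ?thesis
        using True ll cost[of 1] by (intro that[of 1]) (auto simp: x_def)
    next
      case False
      then have "real n \<le> (2 * x)\<^sup>2"
        using x by (intro sqrt_le_D) auto
      then have "loglog (real n) \<le> 3 * loglog x"
        using x by (intro loglog_le_of_square) (auto simp: power_mult_distrib)
      \<comment> \<open>17 = 5 * 3 + 2, with the two extra epochs charged to \<open>loglog x\<close>
        \<ge> 1.\<close>
      then have "real (s_zero n + 2) \<le> 17 * loglog x"
        using s_zero_le_loglog[OF n] loglog_ge_1[of x] by simp
      then have "real n * real (s_zero n + 2) \<le> real n * (17 * loglog x)"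
        by (intro mult_left_mono) auto
      then have "real (n + 3 * n * (s_zero n + 2)) \<le> 100 * (real n * loglog x)"
        using cost[of "s_zero n + 2"] ll n by linarith
      \<comment> \<open>Two late epochs give at least 9n/6, enough for x \<le> n.\<close>
      moreover have "x \<le> weight n (s_zero n + 2)"
        using weight_late'[OF n, of 2] xn by simp
      ultimately show ?thesis using True by (intro that[of "s_zero n + 2"]) (auto simp: x_def)
    qed
  next
    case False
    define r where "r = sqrt (x / real n)"
    have r2: "r\<^sup>2 = x / real n" using x by (simp add: r_def)
    have "1 < x / real n" using False n \<epsilon> by (simp add: x_def field_simps)
    then have r: "1 < r" by (simp add: r_def)
    \<comment> \<open>The factor 3 exceeds the square root of 6, which compensates the 1/6 in
      \<open>weight_late'\<close>.\<close>
    define m where "m = nat \<lceil>3 * r\<rceil>"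
    have m: "3 * r \<le> real m" "real m \<le> 3 * r + 1" using r by (auto simp: m_def)
    have "r\<^sup>2 * 6 \<le> (3 * r)\<^sup>2" by (simp add: power_mult_distrib)
    also have "\<dots> \<le> (real m + 1)\<^sup>2" using m r by (intro power_mono) auto
    finally have "x / real n \<le> (real m + 1)\<^sup>2 / 6" by (simp add: r2)
    then have "x \<le> real n * (real m + 1)\<^sup>2 / 6" using n by (simp add: field_simps)
    then have "x \<le> weight n (s_zero n + m)" using weight_late'[OF n, of m] by linarith
    moreover have "real n * r = sqrt (V * real n / \<epsilon>)"
    proof -
      have "real n * r = sqrt ((real n)\<^sup>2 * (x / real n))" by (simp only: r_def real_sqrt_mult) simp
      also have "(real n)\<^sup>2 * (x / real n) = V * real n / \<epsilon>"
        using n by (simp add: x_def power2_eq_square)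
      finally show ?thesis .
    qed
    moreover have "real (n + 3 * n * (s_zero n + m)) \<le> 100 * (real n * loglog (real n) + real n * r)"
    proof -
      have "real (s_zero n + m) \<le> 6 * loglog (real n) + 3 * r"
        using s_zero_le_loglog[OF n] m loglog_ge_1[of "real n"] by simp
      then have "real n * real (s_zero n + m) \<le> real n * (6 * loglog (real n) + 3 * r)"
        by (intro mult_left_mono) auto
      also have "\<dots> = 6 * (real n * loglog (real n)) + 3 * (real n * r)"
        by (simp add: algebra_simps)
      finally have "real n * real (s_zero n + m)
          \<le> 6 * (real n * loglog (real n)) + 3 * (real n * r)" .
      moreover have "0 \<le> real n * loglog (real n)" "0 \<le> real n * r"
        using r loglog_ge_1[of "real n"] by auto
      ultimately have "4 * (real n * real (s_zero n + m)) \<le> 100 * (real n * loglog (real n) + real n * r)"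
        unfolding distrib_left[of 100] by linarith
      with cost[OF trans_le_add1[OF s_zero_bounds(1)[OF n]], of m] show ?thesis
        by (rule order_trans)
    qed
    ultimately show ?thesis
      using False s_zero_bounds(1)[OF n] by (intro that[of "s_zero n + m"]) (auto simp: x_def)
  qed
qed

theorem theoremA1:
  shows "\<exists>C::real. C > 0 \<and>
    (\<forall>(n::nat) (d::nat) (X::finseq set) (f::nat \<Rightarrow> finseq \<Rightarrow> real) (h::finseq \<Rightarrow> real)
       (\<beta>::real) (u0::finseq) (xstar::finseq) (\<gamma>::real) (\<eta>::real) (D::real) (\<epsilon>::real) (F::finseq \<Rightarrow> real) (V::real).
      n \<ge> 1 \<longrightarrow> d \<ge> 1 \<longrightarrow>
      X \<subseteq> Rd d \<longrightarrow> X \<noteq> {} \<longrightarrow> compact X \<longrightarrow> convex X \<longrightarrow>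
      D > 0 \<longrightarrow> diameter X \<le> D \<longrightarrow>
      \<beta> > 0 \<longrightarrow>
      (\<forall>i\<in>{1..n}. convex_on (Rd d) (f i) \<and> f i differentiable_on Rd d \<and>
         (\<forall>x\<in>Rd d. \<forall>y\<in>Rd d. norm (grad d (f i) x - grad d (f i) y) \<le> \<beta> * norm (x - y))) \<longrightarrow>
      convex_on X h \<longrightarrow>
      (\<forall>l\<ge>0. \<forall>v\<in>Rd d. \<exists>x. is_arg_min (\<lambda>x. l * h x + 1 / 2 * (norm (x - v))\<^sup>2) (\<lambda>x. x \<in> X) x) \<longrightarrow>
      F = (\<lambda>x. average n f x + h x) \<longrightarrow>
      is_arg_min F (\<lambda>x. x \<in> X) xstar \<longrightarrow>
      u0 \<in> X \<longrightarrow> \<gamma> > 0 \<longrightarrow> \<eta> > 0 \<longrightarrow> \<epsilon> > 0 \<longrightarrow>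
      V = 5 / 2 * (F u0 - F xstar) + \<gamma> * (norm (u0 - xstar))\<^sup>2
            + 16 * \<beta> * (D ^ 4 + 2 * \<eta> ^ 4) / \<eta>\<^sup>2 \<longrightarrow>
      (\<exists>S\<ge>1.
         measure_pmf.expectation
           (AdaVRAE d n X f h (step_size n) (\<lambda>_. n) (5 / 4) \<eta> \<gamma> u0 S)
           (\<lambda>st. F (xbar st) - F xstar) \<le> \<epsilon> \<and>
         (\<forall>st\<in>set_pmf (AdaVRAE d n X f h (step_size n) (\<lambda>_. n) (5 / 4) \<eta> \<gamma> u0 S).
            real (evals st) \<le>
              C * (if \<epsilon> \<ge> V / real n then real n * loglog (V / \<epsilon>)
                   else real n * loglog (real n) + sqrt (V * real n / \<epsilon>)))))"
proof -
  have main: "\<exists>S\<ge>1.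
         measure_pmf.expectation
           (AdaVRAE d n X f h (step_size n) (\<lambda>_. n) (5 / 4) \<eta> \<gamma> u0 S)
           (\<lambda>st. F (xbar st) - F xstar) \<le> \<epsilon> \<and>
         (\<forall>st\<in>set_pmf (AdaVRAE d n X f h (step_size n) (\<lambda>_. n) (5 / 4) \<eta> \<gamma> u0 S).
            real (evals st) \<le>
              100 * (if \<epsilon> \<ge> V / real n then real n * loglog (V / \<epsilon>)
                   else real n * loglog (real n) + sqrt (V * real n / \<epsilon>)))"
    if n: "n \<ge> 1" and X: "X \<subseteq> Rd d" "compact X" "convex X"
      and D: "D > 0" "diameter X \<le> D" and \<beta>: "\<beta> > 0"
      and f: "\<forall>i\<in>{1..n}. convex_on (Rd d) (f i) \<and> f i differentiable_on Rd d \<and>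
         (\<forall>x\<in>Rd d. \<forall>y\<in>Rd d. norm (grad d (f i) x - grad d (f i) y) \<le> \<beta> * norm (x - y))"
      and h: "convex_on X h"
        "\<forall>l\<ge>0. \<forall>v\<in>Rd d. \<exists>x. is_arg_min (\<lambda>x. l * h x + 1 / 2 * (norm (x - v))\<^sup>2) (\<lambda>x. x \<in> X) x"
      and F: "F = (\<lambda>x. average n f x + h x)" and xstar: "is_arg_min F (\<lambda>x. x \<in> X) xstar"
      and u0: "u0 \<in> X" and pos: "\<gamma> > 0" "\<eta> > 0" "\<epsilon> > 0"
      and V: "V = 5 / 2 * (F u0 - F xstar) + \<gamma> * (norm (u0 - xstar))\<^sup>2
            + 16 * \<beta> * (D ^ 4 + 2 * \<eta> ^ 4) / \<eta>\<^sup>2"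
    for n d :: nat and X :: "finseq set" and f :: "nat \<Rightarrow> finseq \<Rightarrow> real" and h :: "finseq \<Rightarrow> real"
      and \<beta> \<gamma> \<eta> D \<epsilon> V :: real and u0 xstar :: finseq and F :: "finseq \<Rightarrow> real"
  proof -
    have diam: "norm (x - y) \<le> D" if "x \<in> X" "y \<in> X" for x y
      using diameter_bounded_bound[OF compact_imp_bounded[OF X(2)] that] D(2)
      by (simp add: dist_norm)
    have xs: "xstar \<in> X" "F xstar \<le> F u0" using xstar u0 by (auto simp: is_arg_min_linorder)
    interpret vr_extragradient d n X f h \<beta> \<eta> D xstar
      using n X f h pos \<beta> diam xs(1) by unfold_locales auto
    define Z where "Z = 16 * \<beta> * (D ^ 4 + 2 * \<eta> ^ 4) / \<eta>\<^sup>2"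
    define N where "N = \<gamma> * (norm (u0 - xstar))\<^sup>2"
    have V: "V = 5 / 2 * (F u0 - F xstar) + N + Z" by (simp add: V Z_def N_def)
    have "0 < Z"
      unfolding Z_def using \<beta> D pos by (intro divide_pos_pos mult_pos_pos add_pos_pos) auto
    have "0 \<le> N" unfolding N_def using pos by simp
    with \<open>0 < Z\<close> have V_pos: "V > 0" unfolding V using xs(2) by argo
    have "6 * \<beta> * K\<^sup>2 / \<eta>\<^sup>2 \<le> Z"
    proof -
      \<comment> \<open>This gives K^2 \<le> 2 (D^4/4 + \<eta>^4), so 6 K^2 \<le> 3 D^4 + 12
        \<eta>^4 fits within the constant of V.\<close>
      have "0 \<le> (D\<^sup>2 / 2 - \<eta>\<^sup>2)\<^sup>2" by simp
      then have "K\<^sup>2 \<le> D ^ 4 / 2 + 2 * \<eta> ^ 4"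
        by (simp add: K_def power2_eq_square power4_eq_xxxx algebra_simps)
      moreover have "0 \<le> D ^ 4" "0 \<le> \<eta> ^ 4" by simp_all
      ultimately have "6 * K\<^sup>2 \<le> 16 * (D ^ 4 + 2 * \<eta> ^ 4)" by argo
      then have "\<beta> * (6 * K\<^sup>2) \<le> \<beta> * (16 * (D ^ 4 + 2 * \<eta> ^ 4))"
        using \<beta> by (intro mult_left_mono) auto
      then show ?thesis unfolding Z_def by (intro divide_right_mono) (auto simp: algebra_simps)
    qed
    moreover have "\<gamma> / 2 * (norm (u0 - xstar))\<^sup>2 = N / 2" by (simp add: N_def)
    ultimately have V_ge: "5 / 4 * (F u0 - F xstar) + \<gamma> / 2 * (norm (u0 - xstar))\<^sup>2
        + 6 * \<beta> * K\<^sup>2 / \<eta>\<^sup>2 \<le> V"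
      unfolding V using xs(2) \<open>0 \<le> N\<close> by argo
    obtain S where S: "S \<ge> 1" "V / \<epsilon> \<le> weight n S"
      "real (n + 3 * n * S) \<le> 100 * (if \<epsilon> \<ge> V / real n then real n * loglog (V / \<epsilon>)
                   else real n * loglog (real n) + sqrt (V * real n / \<epsilon>))"
      using enough_epochs[OF n V_pos pos(3)] .
    have W0: "weight n 0 = 5 / 4" by (simp add: weight_def)
    let ?M = "AdaVRAE d n X f h (step_size n) (\<lambda>_. n) (5 / 4) \<eta> \<gamma> u0 S"
    let ?E = "measure_pmf.expectation ?M (\<lambda>st. F (xbar st) - F xstar)"
    note bound = AdaVRAE_bound[where W = "weight n", OF u0 pos(1) step_size_pos[OF n] weight_Suc
        weight_dominates[OF n], unfolded W0]
    have "weight n S * ?E \<le> V"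
      using bound(1)[of S] V_ge unfolding F by linarith
    moreover have "V \<le> weight n S * \<epsilon>" using S(2) pos(3) by (simp add: field_simps)
    ultimately have "weight n S * ?E \<le> weight n S * \<epsilon>" by linarith
    moreover have "0 < weight n S" using S(2) V_pos pos(3) by (meson divide_pos_pos less_le_trans)
    ultimately have "?E \<le> \<epsilon>" by simp
    moreover have "real (evals st) \<le> real (n + 3 * n * S)" if "st \<in> set_pmf ?M" for st
      using bound(2)[OF that] by (simp only: of_nat_le_iff)
    ultimately show ?thesis using S(1,3) order_trans by blast
  qed
  show ?thesis
    by (rule exI[of _ 100], intro conjI allI impI, simp) (rule main; assumption)
qed

end
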